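(* Let $k \geq 4$ and $n \geq k^3+3k^2$ be integers. Then $$\chi\left(\mathrm{KG}(n,k)_{3\text{-stable}}\right) = n-3k+3.$$
   Context: Write $[n]=\{1,\dots,n\}$. For $i,j\in[n]$ with $i\le j$ let $d(i,j)=d(j,i)=\min\{j-i,\ n+i-j\}$ (the distance in the cycle $C_n$ on $[n]$ in its natural order). A $k$-element subset $A\subseteq[n]$ is $s$-stable if $d(i,j)\ge s$ for all distinct $i,j\in A$. The graph $\mathrm{KG}(n,k)_{s\text{-stable}}$ has as vertices all $s$-stable $k$-element subsets of $[n]$, two of them being adjacent if and only if they are disjoint. $\chi$ denotes the chromatic number. *)

theory Defs
  imports Complex_Main "Graph_Theory.Pair_Digraph"
begin

text \<open>
  Undirected graphs are symmetric loop-free digraphs, as in the locale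
  \<^locale>\<open>pair_graph\<close>. A proper colouring with \<open>m\<close> colours uses colours from \<open>{..<m}\<close>.
\<close>

definition proper_colouring :: "'a pair_pre_digraph \<Rightarrow> nat \<Rightarrow> ('a \<Rightarrow> nat) \<Rightarrow> bool" where
  "proper_colouring G m c \<longleftrightarrow>
     (\<forall>v\<in>pverts G. c v < m) \<and> (\<forall>(u, v)\<in>parcs G. c u \<noteq> c v)"

text \<open>
  The least element below exists for every finite loop-free \<open>G\<close>; see
  \<open>chromatic_number_attained\<close>.
\<close>

definition chromatic_number :: "'a pair_pre_digraph \<Rightarrow> nat" where
  "chromatic_number G = (LEAST m. \<exists>c. proper_colouring G m c)"

text \<open>No subtraction truncates when \<open>i\<close> and \<open>j\<close> lie in \<open>{1..n}\<close>.\<close>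

definition cyc_dist :: "nat \<Rightarrow> nat \<Rightarrow> nat \<Rightarrow> nat" where
  "cyc_dist n i j =
     (if i \<le> j then min (j - i) (n + i - j) else min (i - j) (n + j - i))"

definition s_stable :: "nat \<Rightarrow> nat \<Rightarrow> nat set \<Rightarrow> bool" where
  "s_stable n s A \<longleftrightarrow> (\<forall>i\<in>A. \<forall>j\<in>A. i \<noteq> j \<longrightarrow> s \<le> cyc_dist n i j)"

definition stable_ksets :: "nat \<Rightarrow> nat \<Rightarrow> nat \<Rightarrow> nat set set" where
  "stable_ksets n k s = {A. A \<subseteq> {1..n} \<and> card A = k \<and> s_stable n s A}"

text \<open>
  The condition \<open>A \<noteq> B\<close> follows from disjointness unless \<open>k = 0\<close>, where it avoids a loop
  at the empty set.
\<close>

definition stable_kneser_graph :: "nat \<Rightarrow> nat \<Rightarrow> nat \<Rightarrow> nat set pair_pre_digraph" where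
  "stable_kneser_graph n k s =
     \<lparr> pverts = stable_ksets n k s,
       parcs = {(A, B). A \<in> stable_ksets n k s \<and> B \<in> stable_ksets n k s
                          \<and> A \<noteq> B \<and> A \<inter> B = {}} \<rparr>"

lemma cyc_dist_commute: "cyc_dist n i j = cyc_dist n j i"
  by (auto simp: cyc_dist_def)

lemma finite_stable_ksets: "finite (stable_ksets n k s)"
  by (rule finite_subset[of _ "Pow {1..n}"]) (auto simp: stable_ksets_def)

lemma pair_graph_stable_kneser_graph: "pair_graph (stable_kneser_graph n k s)"
proof
  show "finite (parcs (stable_kneser_graph n k s))"
    by (rule finite_subset[of _ "stable_ksets n k s \<times> stable_ksets n k s"])
      (auto simp: stable_kneser_graph_def finite_stable_ksets)
  show "symmetric (with_proj (stable_kneser_graph n k s))"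
    by (auto simp: symmetric_def sym_def stable_kneser_graph_def)
qed (auto simp: stable_kneser_graph_def finite_stable_ksets)

lemma (in pair_digraph) ex_proper_colouring: "\<exists>m c. proper_colouring G m c"
proof -
  obtain f :: "'a \<Rightarrow> nat" and m where f: "f ` pverts G = {i. i < m}" "inj_on f (pverts G)"
    using finite_imp_inj_to_nat_seg[OF pair_finite_verts] by blast
  have "f u \<noteq> f v" if "(u, v) \<in> parcs G" for u v
    using pair_no_loops[OF that] in_arcsD1[OF that] in_arcsD2[OF that] f(2)
    by (auto dest: inj_onD)
  then have "proper_colouring G m f"
    using f(1) by (auto simp: proper_colouring_def)
  then show ?thesis by blast
qed

lemma (in pair_digraph) chromatic_number_attained:
  "\<exists>c. proper_colouring G (chromatic_number G) c"
  unfolding chromatic_number_def using ex_proper_colouring by (rule LeastI_ex)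

end

theory Submission
  imports Defs "HOL-Library.Multiset"
begin

text \<open>
  Suppose that \<open>n - 3k + 2\<close> colours suffice. If some colour class has a common element \<open>i\<close>, then
  the remaining \<open>n - 3k + 1\<close> colours colour the stable sets of the cycle with \<open>i\<close> removed, which is
  one colour too few by the octahedral Tucker lemma. The labels used there come from the longest
  sequence \<open>x\<^sub>1 < x\<^sub>2 < \<dots>\<close> whose terms alternate between the two disjoint sets \<open>A\<close> and \<open>B\<close>, with
  \<open>x\<^sub>i + 3 \<le> x\<^bsub>i+2\<^esub>\<close>. As long as its length is below \<open>2k\<close>, the length together with one extra label for
  the pairs in which maximal sequences start on either side (this happens for even lengths only)
  gives \<open>3k - 2\<close> labels; from length \<open>2k\<close> on, both \<open>A\<close> and \<open>B\<close> contain stable \<open>k\<close>-sets and the largest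
  colour is the label.

  If no colour class has a common element, then a variant of the Hilton-Milner bound shows that each
  class has at most \<open>(k + 1) \<cdot> binomial (n - 2) (k - 2)\<close> members. For \<open>n \<ge> k\<^sup>3 + 3k\<^sup>2\<close> these are too few
  to exhaust all stable \<open>k\<close>-sets.
\<close>

subsection \<open>Fan's parity argument and the octahedral Tucker lemma\<close>

text \<open>Every orbit is a pair \<open>x\<close>, \<open>\<phi> x\<close> and contributes
  \<open>2 * f x\<close>.\<close>

lemma even_sum_involution:
  fixes f :: "'a \<Rightarrow> nat"
  assumes "finite S" "\<And>x. x \<in> S \<Longrightarrow> \<phi> x \<in> S" "\<And>x. x \<in> S \<Longrightarrow> \<phi> (\<phi> x) = x"
    and "\<And>x. x \<in> S \<Longrightarrow> \<phi> x \<noteq> x" "\<And>x. x \<in> S \<Longrightarrow> f (\<phi> x) = f x"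
  shows "even (sum f S)"
  using assms
proof (induction "card S" arbitrary: S rule: less_induct)
  case less
  show ?case
  proof (cases "S = {}")
    case False
    then obtain x where x: "x \<in> S" by blast
    let ?S = "S - {x, \<phi> x}"
    have "card ?S < card S"
      using less.prems(1) x by (intro psubset_card_mono) auto
    moreover have "\<phi> y \<in> ?S" if "y \<in> ?S" for y
      using that less.prems(2,3) x by (metis DiffD1 DiffD2 DiffI insertE insertI1 insertI2 singletonD)
    ultimately have "even (sum f ?S)"
      using less.prems by (intro less.hyps) auto
    moreover have "sum f S = sum f ?S + sum f {x, \<phi> x}"
      using less.prems(1,2) x by (intro sum.subset_diff) auto
    moreover have "sum f {x, \<phi> x} = 2 * f x"
      using less.prems(4,5)[OF x] by simp
    ultimately show ?thesis by simp
  qed simp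
qed

section \<open>Alternating label sequences and the parity of their facets\<close>

fun alternating :: "bool \<Rightarrow> nat list \<Rightarrow> bool" where
  "alternating b [] \<longleftrightarrow> True"
| "alternating b (x # xs) \<longleftrightarrow> even x = b \<and> alternating (\<not> b) xs"

definition omit :: "nat \<Rightarrow> 'a list \<Rightarrow> 'a list" where
  "omit i xs = take i xs @ drop (Suc i) xs"

lemma omit_0 [simp]: "omit 0 (x # xs) = xs"
  and omit_Suc [simp]: "omit (Suc i) (x # xs) = x # omit i xs"
  by (simp_all add: omit_def)

text \<open>If a nonempty \<open>xs\<close> alternates, exactly one omission alternates from sign
  \<open>b\<close>: that of the last entry if \<open>xs\<close> starts with \<open>b\<close>, that
  of the first otherwise. If \<open>xs\<close> does not alternate, there are none or two such
  omissions, since a single pair of neighbours with equal sign can be repaired by dropping either of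
  them. The empty list alternates for both signs.\<close>

lemma even_sum_alternating_omit:
  "even ((\<Sum>i<length xs. of_bool (alternating b (omit i xs))) +
     of_bool (alternating b xs) + of_bool (alternating (\<not> b) xs) :: nat)"
proof (induction xs arbitrary: b)
  case (Cons x xs)
  have "(\<Sum>i<length (x # xs). of_bool (alternating b (omit i (x # xs)))) =
      (of_bool (alternating b xs) + (if even x = b
        then \<Sum>i<length xs. of_bool (alternating (\<not> b) (omit i xs)) else 0) :: nat)"
    by (simp add: sum.lessThan_Suc_shift del: sum.lessThan_Suc)
  then show ?case
    using Cons.IH[of "\<not> b"] by (auto simp: algebra_simps split: if_splits)
qed simp

lemma mset_omit: "i < length xs \<Longrightarrow> mset (omit i xs) = mset xs - {#xs ! i#}"
  unfolding omit_def
  by (subst (3) id_take_nth_drop[of i xs]) auto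

lemma sum_omit_mset:
  "(\<Sum>i<length xs. f (mset (omit i xs))) = (\<Sum>x\<in>#mset xs. f (mset xs - {#x#}))"
proof -
  have "(\<Sum>x\<in>#mset xs. f (mset xs - {#x#})) = (\<Sum>x\<leftarrow>xs. f (mset xs - {#x#}))"
    by (metis mset_map sum_mset_sum_list)
  also have "\<dots> = (\<Sum>i<length xs. f (mset xs - {#xs ! i#}))"
    by (simp add: sum_list_sum_nth atLeast0LessThan)
  finally show ?thesis
    by (simp add: mset_omit)
qed

lemma sorted_omit: "sorted xs \<Longrightarrow> sorted (omit i xs)"
proof (induction xs arbitrary: i)
  case (Cons x xs)
  have "set (omit j xs) \<subseteq> set xs" for j
    by (auto simp: omit_def dest: in_set_takeD in_set_dropD)
  with Cons show ?case
    by (cases i) auto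
qed (simp add: omit_def)

text \<open>Sorting after an omission depends only on the multiset that is left, so omitting
  positions of \<open>xs\<close> or of \<open>sort xs\<close> produces the same sorted lists equally
  often. This reduces the claim to the sorted list.\<close>

lemma even_sum_alternating_sort_omit:
  "even ((\<Sum>i<length xs. of_bool (alternating b (sort (omit i xs)))) +
     of_bool (alternating b (sort xs)) + of_bool (alternating (\<not> b) (sort xs)) :: nat)"
proof -
  let ?f = "\<lambda>M. of_bool (alternating b (sorted_list_of_multiset M)) :: nat"
  have "(\<Sum>i<length xs. ?f (mset (omit i xs))) = (\<Sum>i<length (sort xs). ?f (mset (omit i (sort xs))))"
    by (subst (1 2) sum_omit_mset) simp
  then have "(\<Sum>i<length xs. of_bool (alternating b (sort (omit i xs)))) =
    (\<Sum>i<length (sort xs). of_bool (alternating b (omit i (sort xs))) :: nat)"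
    by (simp add: sorted_list_of_multiset_mset sorted_sort_id sorted_omit)
  then show ?thesis
    using even_sum_alternating_omit[of b "sort xs"] by simp
qed

text \<open>In a sorted list equal entries are neighbours, and neighbours differ in parity.\<close>

lemma alternating_sorted_imp_distinct: "sorted xs \<Longrightarrow> alternating b xs \<Longrightarrow> distinct xs"
proof (induction xs arbitrary: b)
  case (Cons x xs)
  have "x \<notin> set xs"
  proof
    assume "x \<in> set xs"
    then obtain y ys where "xs = y # ys" "y \<le> x"
      using Cons.prems by (cases xs) auto
    with Cons.prems show False by auto
  qed
  with Cons show ?case by auto
qed simp

text \<open>The label \<open>+i\<close> is encoded as \<open>2 * i\<close>, and \<open>-i\<close> as \<open>2 * i + 1\<close>.\<close>
definition flip_sign :: "nat \<Rightarrow> nat" where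
  "flip_sign x = (if even x then x + 1 else x - 1)"

lemma even_flip_sign [simp]: "even (flip_sign x) \<longleftrightarrow> odd x"
  by (auto simp: flip_sign_def)

lemma alternating_map_flip_sign: "alternating b (map flip_sign xs) = alternating (\<not> b) xs"
  by (induction xs arbitrary: b) auto

text \<open>\<open>flip_sign\<close> only exchanges \<open>2 * i\<close> with
  \<open>2 * i + 1\<close>, so it can reverse the order of two numbers only if they form such a
  pair.\<close>

lemma flip_sign_mono:
  assumes "x \<le> y" "y \<noteq> flip_sign x" shows "flip_sign x \<le> flip_sign y"
  using assms by (auto simp: flip_sign_def elim!: evenE oddE; presburger)

lemma sort_map_flip_sign:
  assumes "\<And>x y. x \<in> set xs \<Longrightarrow> y \<in> set xs \<Longrightarrow> y \<noteq> flip_sign x"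
  shows "sort (map flip_sign xs) = map flip_sign (sort xs)"
proof (rule properties_for_sort)
  have "sorted_wrt (\<lambda>x y. flip_sign x \<le> flip_sign y) (sort xs)"
    using assms by (intro sorted_wrt_mono_rel[OF _ sorted_sort]) (auto intro: flip_sign_mono)
  then show "sorted (map flip_sign (sort xs))"
    by (simp add: sorted_map)
qed simp

section \<open>Maximal chains of signed subsets and their labels\<close>

text \<open>A signed order \<open>w\<close> of \<open>V\<close> encodes the maximal chain of signed subsets of \<open>V\<close> formed by the
  nonempty prefixes of \<open>w\<close>; \<open>(v, True)\<close> stands for \<open>+v\<close>.\<close>
definition signed_orders :: "'a set \<Rightarrow> ('a \<times> bool) list set" where
  "signed_orders V = {w. distinct (map fst w) \<and> fst ` set w = V}"

definition chain_labels :: "(('a \<times> bool) set \<Rightarrow> nat) \<Rightarrow> ('a \<times> bool) list \<Rightarrow> nat list" where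
  "chain_labels lab w = map (\<lambda>i. lab (set (take (Suc i) w))) [0..<length w]"

lemma length_chain_labels [simp]: "length (chain_labels lab w) = length w"
  by (simp add: chain_labels_def)

lemma length_signed_orders: "w \<in> signed_orders V \<Longrightarrow> length w = card V"
  unfolding signed_orders_def by (metis (mono_tags, lifting) distinct_card length_map list.set_map mem_Collect_eq)

lemma finite_signed_orders: "finite V \<Longrightarrow> finite (signed_orders V)"
  by (rule finite_subset[of _ "{w. set w \<subseteq> V \<times> UNIV \<and> length w = card V}"])
    (auto simp: length_signed_orders finite_lists_length_eq, auto simp: signed_orders_def image_iff Bex_def)

lemma omit_last: "length xs = Suc n \<Longrightarrow> omit n xs = butlast xs"
  by (simp add: omit_def butlast_conv_take)

lemma butlast_chain_labels: "butlast (chain_labels lab w) = chain_labels lab (butlast w)"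
  by (cases "length w") (auto simp: chain_labels_def butlast_conv_take take_map min_def)


lemma omit_cong:
  assumes "length xs = length ys" "\<And>j. j < length xs \<Longrightarrow> j \<noteq> i \<Longrightarrow> xs ! j = ys ! j"
  shows "omit i xs = omit i ys"
  using assms unfolding omit_def
  by (intro arg_cong2[of _ _ _ _ "(@)"] nth_equalityI) auto

definition swap_next :: "nat \<Rightarrow> 'a list \<Rightarrow> 'a list" where
  "swap_next i w = w[i := w ! Suc i, Suc i := w ! i]"

lemma length_swap_next [simp]: "length (swap_next i w) = length w"
  by (simp add: swap_next_def)

lemma swap_next_swap_next: "Suc i < length w \<Longrightarrow> swap_next i (swap_next i w) = w"
  by (rule nth_equalityI) (auto simp: swap_next_def nth_list_update)

lemma mset_swap_next: "Suc i < length w \<Longrightarrow> mset (swap_next i w) = mset w"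
  unfolding swap_next_def by (rule mset_swap) auto

text \<open>Only the prefix of length \<open>Suc i\<close> separates the two exchanged entries;
  every other prefix contains both or neither. Hence the exchange replaces a single member of the
  chain.\<close>

lemma set_take_swap_next:
  assumes "Suc i < length w" "j \<noteq> i"
  shows "set (take (Suc j) (swap_next i w)) = set (take (Suc j) w)"
proof (cases "j < i")
  case True
  then show ?thesis by (simp add: swap_next_def)
next
  case False
  with assms have "i < length (take (Suc j) w)" "Suc i < length (take (Suc j) w)"
    by auto
  from set_swap[OF this] show ?thesis
    using False assms by (simp add: swap_next_def take_update_swap)
qed

lemma omit_chain_labels_swap_next:
  "Suc i < length w \<Longrightarrow>
    omit i (chain_labels lab (swap_next i w)) = omit i (chain_labels lab w)"
  by (rule omit_cong) (auto simp: chain_labels_def set_take_swap_next)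

lemma swap_next_in_signed_orders:
  assumes "w \<in> signed_orders V" "Suc i < length w"
  shows "swap_next i w \<in> signed_orders V"
proof -
  have "mset (map fst (swap_next i w)) = mset (map fst w)"
    using mset_swap_next[OF assms(2)] by simp
  then have "distinct (map fst (swap_next i w))"
    using assms(1) unfolding signed_orders_def by (metis (mono_tags, lifting) mem_Collect_eq mset_eq_imp_distinct_iff)
  then show ?thesis
    using assms(1) mset_eq_setD[OF mset_swap_next[OF assms(2)]] by (simp add: signed_orders_def)
qed

lemma swap_next_neq:
  assumes "w \<in> signed_orders V" "Suc i < length w"
  shows "swap_next i w \<noteq> w"
proof
  assume "swap_next i w = w"
  then have "w ! i = w ! Suc i"
    using assms(2) by (metis length_swap_next n_not_Suc_n nth_list_update_eq nth_list_update_neq swap_next_def Suc_lessD length_list_update)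
  moreover have "distinct w"
    using assms(1) by (auto simp: signed_orders_def distinct_map)
  ultimately show False
    using assms(2) by (simp add: nth_eq_iff_index_eq)
qed

lemma inj_on_fst_take_signed_orders:
  assumes "w \<in> signed_orders V"
  shows "inj_on fst (set (take i w))" "fst ` set (take i w) \<subseteq> V"
proof -
  show "inj_on fst (set (take i w))"
    using assms by (auto simp: signed_orders_def distinct_map intro: inj_on_subset dest: in_set_takeD)
  show "fst ` set (take i w) \<subseteq> V"
    using assms by (auto simp: signed_orders_def dest: in_set_takeD)
qed

lemma map_negate_in_signed_orders:
  "w \<in> signed_orders V \<Longrightarrow> map (apsnd Not) w \<in> signed_orders V"
  by (auto simp: signed_orders_def image_image comp_def)

text \<open>Sets on which \<open>fst\<close> is injective are the signed subsets. The last two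
  assumptions are those of Tucker's lemma: the labelling is antipodal, and comparable signed subsets
  never carry opposite labels.\<close>

locale signed_labelling =
  fixes V :: "'a set" and lab :: "('a \<times> bool) set \<Rightarrow> nat"
  assumes finite_V: "finite V"
    and lab_negate: "X \<noteq> {} \<Longrightarrow> fst ` X \<subseteq> V \<Longrightarrow> inj_on fst X \<Longrightarrow>
      lab (apsnd Not ` X) = flip_sign (lab X)"
    and lab_neq_flip: "X \<noteq> {} \<Longrightarrow> X \<subseteq> Y \<Longrightarrow> fst ` Y \<subseteq> V \<Longrightarrow> inj_on fst Y \<Longrightarrow>
      lab Y \<noteq> flip_sign (lab X)"
begin

lemma chain_labels_neq_flip:
  assumes "w \<in> signed_orders U" "U \<subseteq> V"
    and "x \<in> set (chain_labels lab w)" "y \<in> set (chain_labels lab w)"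
  shows "y \<noteq> flip_sign x"
proof -
  obtain i j where i: "i < length w" "x = lab (set (take (Suc i) w))"
    and j: "j < length w" "y = lab (set (take (Suc j) w))"
    using assms(3,4) by (auto simp: chain_labels_def)
  let ?X = "\<lambda>i. set (take (Suc i) w)"
  have ne: "?X i \<noteq> {}" "?X j \<noteq> {}"
    using i j by auto
  have V: "inj_on fst (?X l)" "fst ` ?X l \<subseteq> V" for l
    using inj_on_fst_take_signed_orders[OF assms(1)] assms(2) by blast+
  show ?thesis
  proof (cases "i \<le> j")
    case True
    then have "?X i \<subseteq> ?X j" by (intro set_take_subset_set_take) auto
    from lab_neq_flip[OF ne(1) this V(2,1)] show ?thesis using i j by simp
  next
    case False
    then have "?X j \<subseteq> ?X i" by (intro set_take_subset_set_take) auto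
    from lab_neq_flip[OF ne(2) this V(2,1)] have "x \<noteq> flip_sign y" using i j by simp
    then show ?thesis by (auto simp: flip_sign_def)
  qed
qed

lemma alternating_negate:
  assumes w: "w \<in> signed_orders U" "U \<subseteq> V"
  shows "alternating b (sort (chain_labels lab (map (apsnd Not) w))) =
    alternating (\<not> b) (sort (chain_labels lab w))"
proof -
  have "chain_labels lab (map (apsnd Not) w) = map flip_sign (chain_labels lab w)"
    unfolding chain_labels_def map_map length_map
  proof (rule map_cong[OF refl], unfold comp_def)
    fix i assume "i \<in> set [0..<length w]"
    then have "set (take (Suc i) w) \<noteq> {}"
      by auto
    then show "lab (set (take (Suc i) (map (apsnd Not) w))) = flip_sign (lab (set (take (Suc i) w)))"
      using inj_on_fst_take_signed_orders[OF w(1)] w(2)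
      by (subst lab_negate[symmetric]) (auto simp: take_map)
  qed
  then show ?thesis
    using chain_labels_neq_flip[OF w]
    by (simp add: sort_map_flip_sign alternating_map_flip_sign)
qed

abbreviation alternating_count :: "'a set \<Rightarrow> nat" where
  "alternating_count U \<equiv> (\<Sum>w\<in>signed_orders U. of_bool (alternating True (sort (chain_labels lab w))))"

text \<open>Count the pairs of a chain in the hemisphere \<open>H\<close> and a position whose omission leaves an
  alternating sequence of labels. Chains that differ only at the omitted position are paired off,
  except when the last position is omitted and \<open>v\<close> stands there; these are the chains of the equator.\<close>
lemma even_alternating_count_insert:
  assumes v: "insert v U \<subseteq> V" "v \<notin> U"
  shows "even (alternating_count (insert v U) + alternating_count U)"
proof -
  define W where "W = signed_orders (insert v U)"
  define H where "H = {w \<in> W. (v, True) \<in> set w}"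
  define n where "n = card U"
  let ?F = "\<lambda>b w. of_bool (alternating b (sort (chain_labels lab w))) :: nat"
  let ?G = "\<lambda>i w. of_bool (alternating True (sort (omit i (chain_labels lab w)))) :: nat"
  have finU: "finite U" using v finite_V finite_subset by auto
  have len: "length w = Suc n" if "w \<in> W" for w
    using that length_signed_orders finU v(2) by (fastforce simp: W_def n_def)
  have finW: "finite W" using finU by (simp add: W_def finite_signed_orders)
  then have finH: "finite H" by (simp add: H_def)
  have even_i: "even (sum (?G i) H)" if "i < n" for i
  proof (rule even_sum_involution[where \<phi> = "swap_next i", OF finH])
    fix w assume "w \<in> H"
    then have w: "w \<in> signed_orders (insert v U)" "Suc i < length w" "(v, True) \<in> set w"
      using that len by (auto simp: H_def W_def)
    show "swap_next i w \<in> H"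
      using swap_next_in_signed_orders[OF w(1,2)] w(3) mset_eq_setD[OF mset_swap_next[OF w(2)]]
      by (simp add: H_def W_def)
    show "swap_next i (swap_next i w) = w" "swap_next i w \<noteq> w"
      using w swap_next_swap_next swap_next_neq by blast+
    show "?G i (swap_next i w) = ?G i w"
      using w by (simp add: omit_chain_labels_swap_next)
  qed
  have G_n: "?G n w = ?F True (butlast w)" if "w \<in> W" for w
    using len[OF that] by (simp add: omit_last butlast_chain_labels)
  define L where "L = {w \<in> H. last w = (v, True)}"
  \<comment> \<open>If \<open>v\<close> is not the last entry, reversing the sign of the last entry
    stays within \<open>H\<close> and leaves the remaining prefix untouched.\<close>
  have "even (sum (?G n) (H - L))"
  proof (rule even_sum_involution[where \<phi> = "\<lambda>w. butlast w @ [apsnd Not (last w)]"])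
    fix w assume w: "w \<in> H - L"
    then have wW: "w \<in> W" by (simp add: H_def)
    obtain u l where u: "w = u @ [l]" using len[OF wW] by (metis length_Suc_conv_rev)
    have l: "l \<noteq> (v, True)" "(v, True) \<in> set u" "fst l \<noteq> v"
      using w u by (auto simp: L_def H_def W_def signed_orders_def) (metis fst_conv imageI)
    have mem: "u @ [apsnd Not l] \<in> W"
      using wW u by (auto simp: W_def signed_orders_def)
    with l u show "butlast w @ [apsnd Not (last w)] \<in> H - L"
      by (cases l) (auto simp: H_def L_def)
    from mem wW u show "?G n (butlast w @ [apsnd Not (last w)]) = ?G n w"
      by (simp add: G_n)
    show "butlast w @ [apsnd Not (last w)] \<noteq> w"
      using u by (cases l) auto
    show "butlast (butlast w @ [apsnd Not (last w)]) @
        [apsnd Not (last (butlast w @ [apsnd Not (last w)]))] = w"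
      using u by (cases l) auto
  qed (use finH in auto)
  moreover have "sum (?G n) L = alternating_count U"
  proof (rule sum.reindex_bij_witness[where j = butlast and i = "\<lambda>u. u @ [(v, True)]"])
    fix w assume w: "w \<in> L"
    then have wW: "w \<in> W" by (simp add: H_def L_def)
    then have ne: "w \<noteq> []" using len[OF wW] by auto
    have "last w = (v, True)" using w by (simp add: L_def)
    with append_butlast_last_id[OF ne] show eq: "butlast w @ [(v, True)] = w" by metis
    have "butlast w @ [(v, True)] \<in> W" using wW eq by simp
    then show "butlast w \<in> signed_orders U"
      using v(2) by (auto simp: W_def signed_orders_def)
    show "?F True (butlast w) = ?G n w"
      using wW by (simp add: G_n)
  next
    fix u assume "u \<in> signed_orders U"
    then show "u @ [(v, True)] \<in> L" "butlast (u @ [(v, True)]) = u"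
      using v(2) by (auto simp: L_def H_def W_def signed_orders_def)
  qed
  moreover have "sum (?G n) H = sum (?G n) (H - L) + sum (?G n) L"
    using finH by (intro sum.subset_diff) (auto simp: L_def)
  ultimately have even_n: "even (sum (?G n) H + alternating_count U)"
    by simp
  have "even (\<Sum>w\<in>H. (\<Sum>i<Suc n. ?G i w) + ?F True w + ?F False w)"
  proof (rule dvd_sum)
    fix w assume "w \<in> H"
    then have "length (chain_labels lab w) = Suc n" using len by (simp add: H_def)
    then show "even ((\<Sum>i<Suc n. ?G i w) + ?F True w + ?F False w)"
      using even_sum_alternating_sort_omit[of True "chain_labels lab w"] by simp
  qed
  then have "even ((\<Sum>w\<in>H. \<Sum>i<Suc n. ?G i w) + (\<Sum>w\<in>H. ?F True w) + (\<Sum>w\<in>H. ?F False w))"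
    by (simp only: sum.distrib)
  moreover have "(\<Sum>w\<in>H. \<Sum>i<Suc n. ?G i w) = (\<Sum>i<n. sum (?G i) H) + sum (?G n) H"
    by (subst sum.swap) simp
  moreover have "even (\<Sum>i<n. sum (?G i) H)"
    by (rule dvd_sum) (use even_i in simp)
  \<comment> \<open>Exactly one of a chain and its negation lies in \<open>H\<close>, and negation
    reverses the starting sign. So the two counts over \<open>H\<close> together make up the count
    over all chains.\<close>
  moreover have "(\<Sum>w\<in>H. ?F False w) = (\<Sum>w\<in>W - H. ?F True w)"
  proof (rule sum.reindex_bij_witness[where j = "map (apsnd Not)" and i = "map (apsnd Not)"])
    have neg: "map (apsnd Not) w \<in> W" if "w \<in> W" for w
      using that map_negate_in_signed_orders by (simp add: W_def)
    have one: "(v, True) \<in> set w \<longleftrightarrow> (v, False) \<notin> set w" if "w \<in> W" for w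
    proof -
      have "inj_on fst (set w)" "v \<in> fst ` set w"
        using that by (auto simp: W_def signed_orders_def distinct_map)
      moreover from this obtain b where "(v, b) \<in> set w" by auto
      ultimately show ?thesis
        using inj_onD[of fst "set w" "(v, True)" "(v, False)"] by (cases b) auto
    qed
    have img: "(v, b) \<in> apsnd Not ` set w \<longleftrightarrow> (v, \<not> b) \<in> set w" for b and w :: "('a \<times> bool) list"
      by (force simp: image_iff)
    show "map (apsnd Not) (map (apsnd Not) w) = w" for w :: "('a \<times> bool) list"
      by (induction w) auto
    then show "map (apsnd Not) (map (apsnd Not) w) = w" for w :: "('a \<times> bool) list" .
    show "map (apsnd Not) w \<in> W - H" if "w \<in> H" for w
      using that neg[of w] one[of w] by (auto simp: H_def img)
    show "map (apsnd Not) w \<in> H" if "w \<in> W - H" for w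
      using that neg[of w] one[of w] by (auto simp: H_def img)
    show "?F True (map (apsnd Not) w) = ?F False w" if "w \<in> H" for w
      using that alternating_negate[of w "insert v U"] v(1) by (simp add: H_def W_def)
  qed
  moreover have "alternating_count (insert v U) = (\<Sum>w\<in>W - H. ?F True w) + (\<Sum>w\<in>H. ?F True w)"
    unfolding W_def[symmetric] using finW by (intro sum.subset_diff) (auto simp: H_def)
  ultimately show ?thesis
    using even_n by (auto simp only: even_add)
qed

text \<open>Adding one element at a time keeps the parity, and for the empty set the only chain is
  the empty one, which alternates.\<close>

lemma odd_alternating_count: "odd (alternating_count V)"
proof -
  have "odd (alternating_count U)" if "finite U" "U \<subseteq> V" for U
    using that
  proof (induction U)
    case empty
    have "signed_orders {} = {[] :: ('a \<times> bool) list}"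
      by (auto simp: signed_orders_def)
    then show ?case by (simp add: chain_labels_def)
  next
    case (insert v U)
    then show ?case using even_alternating_count_insert[of v U] by auto
  qed
  then show ?thesis using finite_V by blast
qed

text \<open>Some chain has alternating labels. These are distinct and no two are opposite, so their
  absolute values are \<open>card V\<close> different numbers below \<open>m\<close>.\<close>

theorem octahedral_tucker:
  assumes lt: "\<And>X. X \<noteq> {} \<Longrightarrow> fst ` X \<subseteq> V \<Longrightarrow> inj_on fst X \<Longrightarrow> lab X div 2 < m"
  shows "card V \<le> m"
proof -
  obtain w where w: "w \<in> signed_orders V" "alternating True (sort (chain_labels lab w))"
    using odd_alternating_count by (metis (mono_tags, lifting) even_zero of_bool_eq(1) sum.neutral)
  let ?L = "chain_labels lab w"
  have "distinct ?L"
    using alternating_sorted_imp_distinct[OF sorted_sort w(2)] by simp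
  then have "card V = card (set ?L)"
    using length_signed_orders[OF w(1)] by (simp add: distinct_card)
  also have "\<dots> = card ((\<lambda>l. l div 2) ` set ?L)"
  proof (rule card_image[symmetric], rule inj_onI)
    fix x y assume xy: "x \<in> set ?L" "y \<in> set ?L" "x div 2 = y div 2"
    then have "y \<noteq> flip_sign x"
      using chain_labels_neq_flip[OF w(1) order.refl] by blast
    with xy(3) show "x = y"
      by (auto simp: flip_sign_def split: if_splits elim!: evenE oddE)
  qed
  also have "\<dots> \<le> card {..<m}"
  proof (rule card_mono)
    have "lab (set (take (Suc i) w)) div 2 < m" if "i < length w" for i
      using that inj_on_fst_take_signed_orders[OF w(1), of "Suc i"]
      by (intro lt) (auto)
    then show "(\<lambda>l. l div 2) ` set ?L \<subseteq> {..<m}"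
      by (auto simp: chain_labels_def)
  qed simp
  finally show ?thesis by simp
qed

end

subsection \<open>Alternating sequences\<close>

text \<open>The two sets exchange roles at each term. Cutting them down to \<open>{a<..}\<close> and
  \<open>{a + 3..}\<close> carries the order and the gap between terms of the same side into the
  recursion, so no explicit sequence is needed.\<close>

fun alt :: "nat \<Rightarrow> nat set \<Rightarrow> nat set \<Rightarrow> bool" where
  "alt 0 A B \<longleftrightarrow> True"
| "alt (Suc n) A B \<longleftrightarrow> (\<exists>a\<in>A. alt n (B \<inter> {a<..}) (A \<inter> {a + 3..}))"

lemma alt_mono: "alt n A B \<Longrightarrow> A \<subseteq> A' \<Longrightarrow> B \<subseteq> B' \<Longrightarrow> alt n A' B'"
proof (induction n arbitrary: A B A' B')
  case (Suc n)
  then obtain a where "a \<in> A" "alt n (B \<inter> {a<..}) (A \<inter> {a + 3..})" by auto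
  moreover have "B \<inter> {a<..} \<subseteq> B' \<inter> {a<..}" "A \<inter> {a + 3..} \<subseteq> A' \<inter> {a + 3..}"
    using Suc.prems by auto
  ultimately have "a \<in> A'" "alt n (B' \<inter> {a<..}) (A' \<inter> {a + 3..})"
    using Suc.IH Suc.prems(2) by blast+
  then show ?case by auto
qed simp

text \<open>The last term is dropped, not the first, so the starting side is kept.\<close>

lemma alt_SucD: "alt (Suc n) A B \<Longrightarrow> alt n A B"
proof (induction n arbitrary: A B)
  case (Suc n)
  then obtain a where "a \<in> A" "alt (Suc n) (B \<inter> {a<..}) (A \<inter> {a + 3..})" by auto
  with Suc.IH show ?case by auto
qed simp

lemma alt_antimono: "alt n A B \<Longrightarrow> m \<le> n \<Longrightarrow> alt m A B"
  by (induction n) (auto simp: le_Suc_eq simp del: alt.simps(2) dest: alt_SucD)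

lemma alt_le_card: "finite A \<Longrightarrow> finite B \<Longrightarrow> alt n A B \<Longrightarrow> n \<le> card A + card B"
proof (induction n arbitrary: A B)
  case (Suc n)
  then obtain a where a: "a \<in> A" "alt n (B \<inter> {a<..}) (A \<inter> {a + 3..})" by auto
  then have "n \<le> card (B \<inter> {a<..}) + card (A \<inter> {a + 3..})"
    using Suc by auto
  moreover have "card (B \<inter> {a<..}) \<le> card B"
    using Suc.prems by (intro card_mono) auto
  moreover have "card (A \<inter> {a + 3..}) < card A"
  proof (rule psubset_card_mono[OF Suc.prems(1)])
    have "a \<notin> A \<inter> {a + 3..}" by simp
    with a(1) show "A \<inter> {a + 3..} \<subset> A" by blast
  qed
  ultimately show ?case by linarith
qed simp

text \<open>Putting \<open>a\<close> in front of a sequence that starts with \<open>b\<close> in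
  \<open>B\<close> can fail only because its second term \<open>x\<close> in \<open>A\<close> is
  less than \<open>a + 3\<close>; then \<open>a < b < x\<close> forces \<open>b = a + 1\<close> and
  \<open>x = a + 2\<close>.\<close>

lemma alt_prepend_fails:
  assumes "alt n B A" "\<not> alt (Suc n) A B" "a \<in> A" "\<And>b. b \<in> B \<Longrightarrow> a < b"
  shows "2 \<le> n \<and> a + 1 \<in> B \<and> a + 2 \<in> A"
proof -
  have B: "B \<inter> {a<..} = B" using assms(4) by auto
  have no: "\<not> alt n B (A \<inter> {a + 3..})"
    using assms(2,3) B by auto
  then obtain n' where n': "n = Suc n'" by (cases n) auto
  with assms(1) obtain b where b: "b \<in> B" "alt n' (A \<inter> {b<..}) (B \<inter> {b + 3..})" by auto
  from no n' b(1) have "\<not> alt n' (A \<inter> {a + 3..} \<inter> {b<..}) (B \<inter> {b + 3..})" by auto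
  then have "\<not> A \<inter> {b<..} \<subseteq> A \<inter> {a + 3..} \<inter> {b<..}" and "n' \<noteq> 0"
    using b(2) alt_mono by (blast, cases n') auto
  then obtain x where "x \<in> A" "b < x" "x \<notin> {a + 3..}" by blast
  moreover have "a < b" using assms(4) b(1) .
  ultimately have "b = a + 1" "x = a + 2" by auto
  with b(1) \<open>x \<in> A\<close> \<open>n' \<noteq> 0\<close> n' show ?thesis by auto
qed

section \<open>Ties: longest sequences starting on either side\<close>

definition tie :: "nat \<Rightarrow> nat set \<Rightarrow> nat set \<Rightarrow> bool" where
  "tie n A B \<longleftrightarrow> alt n A B \<and> alt n B A \<and> \<not> alt (Suc n) A B \<and> \<not> alt (Suc n) B A"

lemma tie_commute: "tie n A B = tie n B A"
  by (auto simp: tie_def)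

lemma tie_nonempty: "tie n A B \<Longrightarrow> 0 < n \<Longrightarrow> A \<noteq> {} \<and> B \<noteq> {}"
  by (cases n) (auto simp: tie_def)

text \<open>In a tie, \<open>Min A\<close> cannot be put in front of a longest sequence that starts
  in \<open>B\<close>.\<close>

lemma tie_Min_less:
  assumes "tie n A B" "finite A" "finite B" "A \<noteq> {}" "Min A < Min B"
  shows "2 \<le> n" "Min B = Min A + 1" "Min A + 2 \<in> A" "Min A + 1 \<in> B"
proof -
  have lt: "Min A < b" if "b \<in> B" for b
    using that assms by (meson Min_le less_le_trans)
  have "2 \<le> n \<and> Min A + 1 \<in> B \<and> Min A + 2 \<in> A"
    using assms lt by (intro alt_prepend_fails) (auto simp: tie_def simp del: alt.simps)
  moreover then have "Min B = Min A + 1"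
    using lt assms(3) by (intro Min_eqI) (auto simp: Suc_le_eq)
  ultimately show "2 \<le> n" "Min B = Min A + 1" "Min A + 2 \<in> A" "Min A + 1 \<in> B" by auto
qed

text \<open>The two minima are consecutive integers, so the parity of a minimum distinguishes the
  sides. This supplies the sign of the label of a tie.\<close>

lemma tie_Min_parity:
  assumes "tie n A B" "finite A" "finite B" "A \<noteq> {}" "B \<noteq> {}" "A \<inter> B = {}"
  shows "even (Min A) \<longleftrightarrow> odd (Min B)"
proof -
  have "Min A \<noteq> Min B" using assms by (metis Min_in disjoint_iff)
  then consider "Min A < Min B" | "Min B < Min A" by linarith
  then show ?thesis
  proof cases
    case 1
    from tie_Min_less(2)[OF assms(1-4) 1] show ?thesis by simp
  next
    case 2
    from tie_Min_less(2)[OF _ assms(3,2,5) 2] assms(1) show ?thesis by (simp add: tie_commute)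
  qed
qed

text \<open>A tie forces the pattern \<open>a \<in> A\<close>, \<open>a + 1 \<in> B\<close>, \<open>a + 2 \<in> A\<close> at the left end (up to exchanging
  \<open>A\<close> and \<open>B\<close>), and two terms of either sequence can be removed there.\<close>
lemma tie_even:
  assumes "tie n A B" "finite A" "finite B" "A \<inter> B = {}"
  shows "even n"
  using assms
proof (induction n arbitrary: A B rule: less_induct)
  case (less n)
  show ?case
  proof (cases "n = 0")
    case False
    have step: "even n" if tie: "tie n A B" and fin: "finite A" "finite B" and "A \<inter> B = {}"
      and ne: "A \<noteq> {}" and lt: "Min A < Min B" for A B
    proof -
      define a where "a = Min A"
      have a: "2 \<le> n" "a + 2 \<in> A" "a + 1 \<in> B" "a \<in> A" "Min B = a + 1"
        using tie_Min_less[OF tie fin ne lt] fin ne by (auto simp: a_def)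
      obtain m where m: "n = Suc (Suc m)" using a(1) by (metis add_2_eq_Suc le_Suc_ex)
      have A: "a \<le> x" if "x \<in> A" for x using that fin by (simp add: a_def)
      have B: "a + 1 \<le> x" if "x \<in> B" for x using that fin a(5) by (metis Min_le)
      \<comment> \<open>The first two terms of any sequence are at least \<open>a\<close> on the
        side of \<open>A\<close> and at least \<open>a + 1\<close> on the side of \<open>B\<close>,
        so all later terms lie in these sets.\<close>
      let ?A = "A \<inter> {a + 3..}" and ?B = "B \<inter> {a + 4..}"
      have "alt m ?A ?B"
      proof -
        from tie m obtain x y where xy: "x \<in> A" "y \<in> B" "x < y"
          "alt m (A \<inter> {x + 3..} \<inter> {y<..}) (B \<inter> {x<..} \<inter> {y + 3..})"
          by (auto simp: tie_def)
        show ?thesis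
          using A[OF xy(1)] B[OF xy(2)] by (intro alt_mono[OF xy(4)]) auto
      qed
      moreover have "alt m ?B ?A"
      proof -
        from tie m obtain x y where xy: "x \<in> B" "y \<in> A" "x < y"
          "alt m (B \<inter> {x + 3..} \<inter> {y<..}) (A \<inter> {x<..} \<inter> {y + 3..})"
          by (auto simp: tie_def)
        show ?thesis
          using A[OF xy(2)] B[OF xy(1)] xy(3) by (intro alt_mono[OF xy(4)]) auto
      qed
      moreover have "\<not> alt (Suc m) ?A ?B"
      proof
        assume *: "alt (Suc m) ?A ?B"
        have "alt (Suc (Suc (Suc m))) A B"
          unfolding alt.simps(2)[of "Suc (Suc m)"] alt.simps(2)[of "Suc m"]
          using a by (intro bexI[of _ a] bexI[of _ "a + 1"] alt_mono[OF *]) auto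
        with tie m show False by (simp add: tie_def)
      qed
      moreover have "\<not> alt (Suc m) ?B ?A"
      proof
        assume "alt (Suc m) ?B ?A"
        \<comment> \<open>The first term lies in \<open>B\<close> and is at least
          \<open>a + 4\<close>, so the terms in \<open>A\<close> are at least \<open>a + 5\<close>.
          This leaves room for \<open>a + 1\<close> and \<open>a + 2\<close> in front.\<close>
        then have *: "alt (Suc m) ?B (A \<inter> {a + 5..})"
        proof -
          from \<open>alt (Suc m) ?B ?A\<close> obtain x where x: "x \<in> ?B"
            "alt m (?A \<inter> {x<..}) (?B \<inter> {x + 3..})" by auto
          have "alt m (A \<inter> {a + 5..} \<inter> {x<..}) (?B \<inter> {x + 3..})"
            using x(1) by (intro alt_mono[OF x(2)]) auto
          with x(1) show ?thesis by auto
        qed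
        have "alt (Suc (Suc (Suc m))) B A"
          unfolding alt.simps(2)[of "Suc (Suc m)"] alt.simps(2)[of "Suc m"]
          using a by (intro bexI[of _ "a + 1"] bexI[of _ "a + 2"] alt_mono[OF *]) auto
        with tie m show False by (simp add: tie_def)
      qed
      ultimately have "tie m ?A ?B" by (simp add: tie_def del: alt.simps)
      with less.IH[of m ?A ?B] m fin \<open>A \<inter> B = {}\<close> show ?thesis by auto
    qed
    have ne: "A \<noteq> {}" "B \<noteq> {}" using tie_nonempty less.prems(1) False by auto
    then have "Min A \<noteq> Min B" using less.prems by (metis Min_in disjoint_iff)
    then consider "Min A < Min B" | "Min B < Min A" by linarith
    then show ?thesis
    proof cases
      case 1
      show ?thesis by (rule step[of A B]) (use 1 less.prems ne in auto)
    next
      case 2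
      show ?thesis by (rule step[of B A]) (use 2 less.prems ne in \<open>auto simp: tie_commute\<close>)
    qed
  qed simp
qed

text \<open>Were \<open>Min A'\<close> smaller, it could be put in front of a longest sequence of
  the smaller pair starting in \<open>B\<close>: that sequence starts at \<open>Min A' + 2\<close>
  or later, so its terms in \<open>A\<close> are at least \<open>Min A' + 3\<close>. The result
  would be too long for a tie.\<close>

lemma tie_Min_eq:
  assumes "tie n A B" "tie n A' B'" "A \<subseteq> A'" "B \<subseteq> B'" "finite A'" "finite B'"
    and ne: "A \<noteq> {}" and lt: "Min A < Min B"
  shows "Min A' = Min A"
proof (rule ccontr)
  assume "Min A' \<noteq> Min A"
  moreover have "Min A' \<le> Min A" using assms by (simp add: Min_antimono)
  ultimately have less: "Min A' < Min A" by simp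
  have fin: "finite A" "finite B" using assms finite_subset by auto
  have mB: "Min A + 1 \<le> x" if "x \<in> B" for x
    using lt Min_le[OF fin(2) that] by simp
  obtain m where m: "n = Suc m" using tie_Min_less(1)[OF assms(1) fin ne lt] by (cases n) auto
  from assms(1) m obtain b where b: "b \<in> B" "alt m (A \<inter> {b<..}) (B \<inter> {b + 3..})"
    by (auto simp: tie_def)
  have "alt m (A' \<inter> {Min A' + 3..} \<inter> {b<..}) (B' \<inter> {Min A'<..} \<inter> {b + 3..})"
    using mB[OF b(1)] less assms(3,4) by (intro alt_mono[OF b(2)]) auto
  moreover have "b \<in> B'" "Min A' < b" using b(1) assms(4) mB[OF b(1)] less by auto
  moreover have "Min A' \<in> A'" using assms by (intro Min_in) auto
  ultimately have "alt (Suc n) A' B'" unfolding m by auto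
  with assms(2) show False by (simp add: tie_def)
qed

text \<open>The side with the smaller minimum keeps its minimum. If that side is \<open>B\<close>,
  the opposite parities of the two minima carry this over to \<open>A\<close>.\<close>

lemma tie_Min_parity_mono:
  assumes tie: "tie n A B" "tie n A' B'" and sub: "A \<subseteq> A'" "B \<subseteq> B'"
    and fin: "finite A'" "finite B'" and disj: "A' \<inter> B' = {}" and "0 < n"
  shows "even (Min A) \<longleftrightarrow> even (Min A')"
proof -
  have ne: "A \<noteq> {}" "B \<noteq> {}" using tie_nonempty tie assms(8) by auto
  have fin': "finite A" "finite B" using fin sub finite_subset by auto
  have "A \<inter> B = {}" using disj sub by auto
  then have "Min A \<noteq> Min B" using fin' ne by (metis Min_in disjoint_iff)
  then consider "Min A < Min B" | "Min B < Min A" by linarith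
  then show ?thesis
  proof cases
    case 1
    from tie_Min_eq[OF tie sub fin ne(1) 1] show ?thesis by simp
  next
    case 2
    have "Min B' = Min B"
      using tie_Min_eq[of n B A B' A'] tie sub fin ne 2 by (simp add: tie_commute)
    then show ?thesis
      using tie_Min_parity[OF tie(1) fin' ne] tie_Min_parity[OF tie(2) fin] ne sub disj by auto
  qed
qed

definition spread :: "nat set \<Rightarrow> bool" where
  "spread C \<longleftrightarrow> (\<forall>x\<in>C. \<forall>y\<in>C. x < y \<longrightarrow> x + 3 \<le> y)"

text \<open>\<open>C\<close> and \<open>D\<close> consist of the terms in odd and in even position.
  The first term lies below all of \<open>D\<close> and the last one above all of \<open>C\<close>;
  these two witnesses later prevent wrapping around the cycle.\<close>

lemma alt_double_imp_spread:
  assumes "alt (2 * k) A B" "0 < k"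
  shows "\<exists>C D. C \<subseteq> A \<and> D \<subseteq> B \<and> finite C \<and> finite D \<and> card C = k \<and> card D = k \<and> spread C \<and> spread D \<and>
    (\<exists>a\<in>A. \<forall>d\<in>D. a < d) \<and> (\<exists>b\<in>B. \<forall>c\<in>C. c < b)"
  using assms
proof (induction k arbitrary: A B)
  case (Suc k)
  then obtain a b where ab: "a \<in> A" "b \<in> B" "a < b"
    and alt: "alt (2 * k) (A \<inter> {a + 3..} \<inter> {b<..}) (B \<inter> {a<..} \<inter> {b + 3..})"
    by auto
  show ?case
  proof (cases "k = 0")
    case True
    with ab show ?thesis
      by (intro exI[of _ "{a}"] exI[of _ "{b}"]) (auto simp: spread_def)
  next
    case False
    from Suc.IH[OF alt] False obtain C D b' where
      CD: "C \<subseteq> A \<inter> {a + 3..} \<inter> {b<..}" "D \<subseteq> B \<inter> {a<..} \<inter> {b + 3..}" "finite C" "finite D"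
        "card C = k" "card D = k" "spread C" "spread D"
      and b': "b' \<in> B" "a < b'" "\<forall>c\<in>C. c < b'"
      by auto
    have "a \<notin> C" "b \<notin> D" using CD by auto
    moreover have "spread (insert a C)" "spread (insert b D)"
      using CD by (auto simp: spread_def)
    ultimately have "card (insert a C) = Suc k" "card (insert b D) = Suc k"
      "spread (insert a C)" "spread (insert b D)"
      using CD by simp_all
    moreover have "insert a C \<subseteq> A" "insert b D \<subseteq> B"
      using CD ab by auto
    moreover have "\<forall>d\<in>insert b D. a < d" "\<forall>c\<in>insert a C. c < b'"
      using CD ab b' by auto
    ultimately show ?thesis
      using CD(3,4) ab(1) b'(1) by blast
  qed
qed simp

subsection \<open>Colourings of the cycle with one vertex removed\<close>

definition alt_len :: "nat set \<Rightarrow> nat set \<Rightarrow> nat" where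
  "alt_len A B = Max {n. alt n A B \<or> alt n B A}"

lemma alt_len_commute: "alt_len A B = alt_len B A"
  by (simp add: alt_len_def disj_commute)

lemma
  assumes fin: "finite A" "finite B"
  shows alt_alt_len: "alt (alt_len A B) A B \<or> alt (alt_len A B) B A"
    and alt_le_alt_len: "alt n A B \<or> alt n B A \<Longrightarrow> n \<le> alt_len A B"
proof -
  let ?S = "{n. alt n A B \<or> alt n B A}"
  have "?S \<subseteq> {..card A + card B}"
    using alt_le_card[OF fin] alt_le_card[OF fin(2,1)] by (auto simp: add.commute)
  then have S: "finite ?S" by (rule finite_subset) simp
  have "0 \<in> ?S" by simp
  with Max_in[OF S] show "alt (alt_len A B) A B \<or> alt (alt_len A B) B A"
    unfolding alt_len_def by blast
  show "alt n A B \<or> alt n B A \<Longrightarrow> n \<le> alt_len A B"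
    unfolding alt_len_def by (rule Max_ge[OF S]) simp
qed

lemma alt_len_pos:
  assumes "finite A" "finite B" "A \<union> B \<noteq> {}"
  shows "0 < alt_len A B"
proof -
  have "alt 1 A B \<or> alt 1 B A" using assms(3) by auto
  from alt_le_alt_len[OF assms(1,2) this] show ?thesis by simp
qed

lemma tie_alt_len_iff:
  assumes "finite A" "finite B"
  shows "tie (alt_len A B) A B \<longleftrightarrow> alt (alt_len A B) A B \<and> alt (alt_len A B) B A"
  using alt_le_alt_len[OF assms, of "Suc (alt_len A B)"] by (auto simp: tie_def simp del: alt.simps)

lemma alt_len_less:
  assumes "finite A" "finite B" "\<not> alt n A B" "\<not> alt n B A"
  shows "alt_len A B < n"
proof (rule ccontr)
  assume "\<not> alt_len A B < n"
  then have "n \<le> alt_len A B" by simp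
  from alt_antimono[OF _ this] alt_alt_len[OF assms(1,2)] assms(3,4) show False by blast
qed

text \<open>The \<open>3\<close>-stable \<open>k\<close>-sets of the cycle on \<open>{0..N}\<close> that avoid \<open>0\<close>.\<close>
definition cut_stable :: "nat \<Rightarrow> nat \<Rightarrow> nat set \<Rightarrow> bool" where
  "cut_stable N k C \<longleftrightarrow> C \<subseteq> {1..N} \<and> card C = k \<and> spread C \<and> \<not> (1 \<in> C \<and> N \<in> C)"

section \<open>Signed labels of pairs of disjoint sets\<close>

locale cut_cycle_colouring =
  fixes N k T :: nat and c :: "nat set \<Rightarrow> nat"
  assumes k_pos: "0 < k" and T_pos: "0 < T"
    and colour_less: "cut_stable N k C \<Longrightarrow> c C < T"
    and colour_neq: "cut_stable N k C \<Longrightarrow> cut_stable N k D \<Longrightarrow> C \<inter> D = {} \<Longrightarrow> c C \<noteq> c D"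
begin

definition colours :: "nat set \<Rightarrow> nat set" where
  "colours A = {c C |C. C \<subseteq> A \<and> cut_stable N k C}"

definition long :: "nat set \<Rightarrow> nat set \<Rightarrow> bool" where
  "long A B \<longleftrightarrow> alt (2 * k) A B \<or> alt (2 * k) B A"

definition top_colour :: "nat set \<Rightarrow> nat set \<Rightarrow> nat" where
  "top_colour A B = Max (colours A \<union> colours B)"

text \<open>Lengths \<open>1, \<dots>, 2k - 1\<close> use the indices below \<open>2k - 1\<close>, ties of length \<open>2, 4, \<dots>, 2k - 2\<close> the next
  \<open>k - 1\<close> indices, and the colours \<open>1, \<dots>, T - 1\<close> the remaining ones.\<close>
definition index :: "nat set \<Rightarrow> nat set \<Rightarrow> nat" where
  "index A B = (if long A B then 3 * k - 3 + top_colour A B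
     else if tie (alt_len A B) A B then 2 * k - 2 + alt_len A B div 2
     else alt_len A B - 1)"

definition positive :: "nat set \<Rightarrow> nat set \<Rightarrow> bool" where
  "positive A B \<longleftrightarrow> (if long A B then top_colour A B \<in> colours A
     else if tie (alt_len A B) A B then even (Min A)
     else alt (alt_len A B) A B)"

lemma long_commute: "long A B = long B A"
  by (auto simp: long_def)

lemma top_colour_commute: "top_colour A B = top_colour B A"
  by (simp add: top_colour_def Un_commute)

lemma index_commute: "index A B = index B A"
  by (simp add: index_def long_commute[of A] top_colour_commute[of A] alt_len_commute[of A]
      tie_commute[of _ A])

lemma finite_colours: "finite (colours A)"
  by (rule finite_subset[of _ "{..<T}"]) (auto simp: colours_def colour_less)

lemma colours_mono: "A \<subseteq> B \<Longrightarrow> colours A \<subseteq> colours B"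
  by (auto simp: colours_def)

lemma colours_disjoint: "A \<inter> B = {} \<Longrightarrow> colours A \<inter> colours B = {}"
  unfolding colours_def using colour_neq by (auto; metis disjoint_iff subset_iff)

text \<open>The witness below \<open>D\<close> excludes \<open>1\<close> from \<open>D\<close>, the
  one above \<open>C\<close> excludes \<open>N\<close> from \<open>C\<close>; so neither set
  contains both ends.\<close>

lemma alt_double_imp_colours:
  assumes "alt (2 * k) A B" "A \<subseteq> {1..N}" "B \<subseteq> {1..N}"
  shows "colours A \<noteq> {} \<and> colours B \<noteq> {}"
proof -
  from alt_double_imp_spread[OF assms(1) k_pos] obtain C D a b where
    CD: "C \<subseteq> A" "D \<subseteq> B" "card C = k" "card D = k" "spread C" "spread D"
    and ab: "a \<in> A" "\<forall>d\<in>D. a < d" "b \<in> B" "\<forall>c\<in>C. c < b"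
    by blast
  have "1 \<le> a" "b \<le> N" using ab assms by auto
  with ab have "1 \<notin> D" "N \<notin> C" by fastforce+
  with CD assms have "cut_stable N k C" "cut_stable N k D" by (auto simp: cut_stable_def)
  with CD show ?thesis by (auto simp: colours_def)
qed

lemma long_imp_colours:
  "long A B \<Longrightarrow> A \<subseteq> {1..N} \<Longrightarrow> B \<subseteq> {1..N} \<Longrightarrow> colours A \<noteq> {} \<and> colours B \<noteq> {}"
  unfolding long_def using alt_double_imp_colours by blast

context
  fixes A B :: "nat set"
  assumes sub: "A \<subseteq> {1..N}" "B \<subseteq> {1..N}" and disj: "A \<inter> B = {}" and ne: "A \<union> B \<noteq> {}"
begin

lemma fin: "finite A" "finite B"
  using sub finite_subset by auto

lemma top_colour_mem: "long A B \<Longrightarrow> top_colour A B \<in> colours A \<union> colours B"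
  unfolding top_colour_def using long_imp_colours sub finite_colours by (intro Max_in) auto

text \<open>Two distinct colours are present, so the largest one is not \<open>0\<close>. This saves one label.\<close>
lemma top_colour_pos:
  assumes "long A B" shows "0 < top_colour A B"
proof -
  obtain p q where pq: "p \<in> colours A" "q \<in> colours B"
    using long_imp_colours assms sub by blast
  then have "p \<noteq> q" using colours_disjoint[OF disj] by blast
  moreover have "p \<le> top_colour A B" "q \<le> top_colour A B"
    unfolding top_colour_def using pq finite_colours by (auto intro!: Max_ge)
  ultimately show ?thesis by linarith
qed

lemma top_colour_less: "long A B \<Longrightarrow> top_colour A B < T"
  using top_colour_mem colour_less by (auto simp: colours_def)

lemma alt_len_bounds:
  assumes "\<not> long A B" shows "0 < alt_len A B" "alt_len A B < 2 * k"
  using alt_len_pos[OF fin ne] alt_len_less[OF fin] assms by (auto simp: long_def)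

lemma even_alt_len: "tie (alt_len A B) A B \<Longrightarrow> even (alt_len A B)"
  using tie_even fin disj by blast

lemma index_less: "index A B < 3 * k - 3 + T"
proof (cases "long A B")
  case True
  then show ?thesis using top_colour_less by (simp add: index_def)
next
  case False
  \<comment> \<open>A tie has even length at most \<open>2 * k - 2\<close>, hence index at most
    \<open>3 * k - 3\<close>, which is in range because \<open>T\<close> is positive.\<close>
  then show ?thesis
    using alt_len_bounds[OF False] even_alt_len T_pos by (auto simp: index_def elim!: evenE)
qed

text \<open>Exactly one side owns the top colour, the minima of a tie have opposite parity, and
  without a tie longest sequences start on one side only.\<close>

lemma positive_commute: "positive B A \<longleftrightarrow> \<not> positive A B"
proof (cases "long A B")
  case True
  then show ?thesis
    using top_colour_mem colours_disjoint[OF disj]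
    by (auto simp: positive_def long_commute[of B] top_colour_commute[of B])
next
  case long: False
  note comm = positive_def long_commute[of B] alt_len_commute[of B] tie_commute[of _ B]
  show ?thesis
  proof (cases "tie (alt_len A B) A B")
    case True
    then have "A \<noteq> {}" "B \<noteq> {}"
      using tie_nonempty alt_len_bounds[OF long] by auto
    from tie_Min_parity[OF True fin this disj] True long show ?thesis
      by (simp add: comm)
  next
    case False
    with tie_alt_len_iff[OF fin] alt_alt_len[OF fin] long show ?thesis
      by (auto simp: comm)
  qed
qed

end

text \<open>The three kinds of pairs have disjoint ranges of indices, so equal indices mean equal
  kinds. Then the top colour stays with its side, or the parity of the minimum persists in a tie, or
  a longest sequence of the smaller pair is still a longest one of the larger pair.\<close>

lemma positive_mono:
  assumes sub: "A \<subseteq> A'" "B \<subseteq> B'" "A' \<subseteq> {1..N}" "B' \<subseteq> {1..N}"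
    and disj: "A' \<inter> B' = {}" and ne: "A \<union> B \<noteq> {}"
    and index: "index A B = index A' B'"
  shows "positive A B = positive A' B'"
proof -
  have sub': "A \<subseteq> {1..N}" "B \<subseteq> {1..N}" and disj': "A \<inter> B = {}" and ne': "A' \<union> B' \<noteq> {}"
    using sub disj ne by auto
  note x = sub' disj' ne and y = sub(3,4) disj ne'
  note fin = fin[OF x] fin[OF y]
  have long_index: "3 * k - 2 \<le> index C D"
    if "long C D" "C \<subseteq> {1..N}" "D \<subseteq> {1..N}" "C \<inter> D = {}" "C \<union> D \<noteq> {}" for C D
    using that top_colour_pos[of C D] by (simp add: index_def)
  have tie_index: "2 * k - 1 \<le> index C D \<and> index C D < 3 * k - 2"
    if "\<not> long C D" "tie (alt_len C D) C D"
      "C \<subseteq> {1..N}" "D \<subseteq> {1..N}" "C \<inter> D = {}" "C \<union> D \<noteq> {}" for C D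
    using that alt_len_bounds[of C D] even_alt_len[of C D] k_pos
    by (auto simp: index_def elim!: evenE)
  have other_index: "index C D < 2 * k - 1"
    if "\<not> long C D" "\<not> tie (alt_len C D) C D"
      "C \<subseteq> {1..N}" "D \<subseteq> {1..N}" "C \<inter> D = {}" "C \<union> D \<noteq> {}" for C D
    using that alt_len_bounds[of C D] by (auto simp: index_def)
  consider "long A B" | "\<not> long A B" "tie (alt_len A B) A B"
    | "\<not> long A B" "\<not> tie (alt_len A B) A B" by blast
  then show ?thesis
  proof cases
    case 1
    have long: "long A' B'"
    proof (rule ccontr)
      assume nl: "\<not> long A' B'"
      have "index A' B' < 3 * k - 2"
      proof (cases "tie (alt_len A' B') A' B'")
        case True
        from tie_index[OF nl this y] show ?thesis ..
      next
        case False
        from other_index[OF nl this y] k_pos show ?thesis by linarith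
      qed
      with long_index[OF 1 x] index show False by linarith
    qed
    from index 1 long have top: "top_colour A B = top_colour A' B'"
      by (simp add: index_def)
    have "top_colour A B \<in> colours A' \<longleftrightarrow> top_colour A B \<in> colours A"
      using top_colour_mem[OF x 1] colours_mono[OF sub(1)] colours_mono[OF sub(2)]
        colours_disjoint[OF disj] by blast
    then show ?thesis by (simp add: positive_def 1 long top)
  next
    case 2
    have nl: "\<not> long A' B'"
    proof
      assume "long A' B'"
      from long_index[OF this y] tie_index[OF 2 x] index show False by simp
    qed
    moreover have "tie (alt_len A' B') A' B'"
    proof (rule ccontr)
      assume "\<not> tie (alt_len A' B') A' B'"
      from other_index[OF nl this y] tie_index[OF 2 x] index show False by simp
    qed
    ultimately have y2: "\<not> long A' B'" "tie (alt_len A' B') A' B'" .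
    have "alt_len A B = alt_len A' B'"
      using index 2 y2 even_alt_len[OF x] even_alt_len[OF y] by (auto simp: index_def elim!: evenE)
    with 2 y2 have "even (Min A) \<longleftrightarrow> even (Min A')"
      using tie_Min_parity_mono[of "alt_len A B" A B A' B'] sub disj fin alt_len_bounds[OF x 2(1)]
      by auto
    with 2 y2 show ?thesis by (simp add: positive_def)
  next
    case 3
    have y3: "\<not> long A' B'"
    proof
      assume "long A' B'"
      from long_index[OF this y] other_index[OF 3 x] index k_pos show False by linarith
    qed
    have y3': "\<not> tie (alt_len A' B') A' B'"
    proof
      assume "tie (alt_len A' B') A' B'"
      from tie_index[OF y3 this y] other_index[OF 3 x] index show False by linarith
    qed
    have len: "alt_len A B = alt_len A' B'"
      using index 3 y3 y3' alt_len_bounds[OF x 3(1)] alt_len_bounds[OF y y3]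
      by (simp add: index_def)
    let ?l = "alt_len A B"
    have "alt ?l A B \<or> alt ?l B A" "\<not> (alt ?l A B \<and> alt ?l B A)"
      using alt_alt_len[OF fin(1,2)] tie_alt_len_iff[OF fin(1,2)] 3(2) by blast+
    moreover have "\<not> (alt ?l A' B' \<and> alt ?l B' A')"
      using tie_alt_len_iff[OF fin(3,4)] y3' len by simp
    moreover have "alt ?l A B \<Longrightarrow> alt ?l A' B'" "alt ?l B A \<Longrightarrow> alt ?l B' A'"
      using alt_mono sub(1,2) by blast+
    ultimately have "alt ?l A B = alt ?l A' B'" by blast
    with len 3 y3 y3' show ?thesis by (simp add: positive_def)
  qed
qed

text \<open>A signed subset is read as the pair of its positive and negative elements;
  \<open>index\<close> and \<open>positive\<close> provide the absolute value and the sign for the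
  octahedral Tucker lemma.\<close>

theorem colours_lower_bound: "N \<le> 3 * k - 3 + T"
proof -
  define pos neg :: "(nat \<times> bool) set \<Rightarrow> nat set"
    where "pos = (\<lambda>X. {v. (v, True) \<in> X})" and "neg = (\<lambda>X. {v. (v, False) \<in> X})"
  define lab where "lab = (\<lambda>X. 2 * index (pos X) (neg X) + of_bool (\<not> positive (pos X) (neg X)))"
  have X: "pos X \<subseteq> {1..N}" "neg X \<subseteq> {1..N}" "pos X \<inter> neg X = {}" "pos X \<union> neg X \<noteq> {}"
    if X: "X \<noteq> {}" "fst ` X \<subseteq> {1..N}" "inj_on fst X" for X
  proof -
    show "pos X \<subseteq> {1..N}" "neg X \<subseteq> {1..N}" using X(2) by (force simp: pos_def neg_def)+
    show "pos X \<inter> neg X = {}"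
      using inj_onD[OF X(3)] by (fastforce simp: pos_def neg_def)
    obtain v b where "(v, b) \<in> X" using X(1) by (metis ex_in_conv surj_pair)
    then show "pos X \<union> neg X \<noteq> {}" by (cases b) (auto simp: pos_def neg_def)
  qed
  have [simp]: "lab X div 2 = index (pos X) (neg X)" "even (lab X) \<longleftrightarrow> positive (pos X) (neg X)" for X
    by (auto simp: lab_def)
  interpret signed_labelling "{1..N}" lab
  proof
    fix X :: "(nat \<times> bool) set" assume X': "X \<noteq> {}" "fst ` X \<subseteq> {1..N}" "inj_on fst X"
    have "pos (apsnd Not ` X) = neg X" "neg (apsnd Not ` X) = pos X"
      by (force simp: pos_def neg_def image_iff)+
    then show "lab (apsnd Not ` X) = flip_sign (lab X)"
      using positive_commute[OF X[OF X']] index_commute[of "pos X" "neg X"]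
      by (auto simp: lab_def flip_sign_def)
  next
    fix X Y :: "(nat \<times> bool) set"
    assume XY: "X \<noteq> {}" "X \<subseteq> Y" "fst ` Y \<subseteq> {1..N}" "inj_on fst Y"
    have sub: "pos X \<subseteq> pos Y" "neg X \<subseteq> neg Y" using XY(2) by (auto simp: pos_def neg_def)
    have Y: "Y \<noteq> {}" using XY by auto
    have X': "fst ` X \<subseteq> {1..N}" "inj_on fst X" using XY inj_on_subset by blast+
    show "lab Y \<noteq> flip_sign (lab X)"
    proof
      assume eq: "lab Y = flip_sign (lab X)"
      have "flip_sign l div 2 = l div 2" for l
        by (auto simp: flip_sign_def elim!: oddE)
      with eq have "lab X div 2 = lab Y div 2" "even (lab X) \<longleftrightarrow> odd (lab Y)"
        by (metis, simp only: even_flip_sign not_not)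
      with positive_mono[OF sub X(1-3)[OF Y XY(3,4)] X(4)[OF XY(1) X']] show False
        by simp
    qed
  qed simp
  have "card {1..N} \<le> 3 * k - 3 + T"
  proof (rule octahedral_tucker)
    fix X :: "(nat \<times> bool) set"
    assume "X \<noteq> {}" "fst ` X \<subseteq> {1..N}" "inj_on fst X"
    from index_less[OF X[OF this]] show "lab X div 2 < 3 * k - 3 + T" by simp
  qed
  then show ?thesis by simp
qed

end

subsection \<open>Intersecting families without a common element\<close>

lemma card_UN_le_mult:
  assumes "finite I" "card I \<le> p" "\<And>i. i \<in> I \<Longrightarrow> card (S i) \<le> q"
  shows "card (\<Union>i\<in>I. S i) \<le> p * q"
proof -
  have "card (\<Union>i\<in>I. S i) \<le> (\<Sum>i\<in>I. card (S i))"
    by (rule card_UN_le[OF assms(1)])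
  also have "\<dots> \<le> card I * q"
    using sum_bounded_above[OF assms(3), of I] by simp
  also have "\<dots> \<le> p * q" using assms(2) by simp
  finally show ?thesis .
qed

locale uniform_family =
  fixes X :: "'a set" and n k :: nat and F :: "'a set set"
  assumes finite_X: "finite X" and card_X: "card X = n"
    and F_sub: "A \<in> F \<Longrightarrow> A \<subseteq> X" and F_card: "A \<in> F \<Longrightarrow> card A = k"
begin

definition star :: "'a set \<Rightarrow> 'a set set" where
  "star Z = {A \<in> F. Z \<subseteq> A}"

lemma finite_F: "finite F"
  using F_sub finite_X by (intro finite_subset[of F "Pow X"]) auto

lemma finite_member: "A \<in> F \<Longrightarrow> finite A"
  using F_sub finite_X finite_subset by blast

lemma card_star_le:
  assumes "finite Z"
  shows "card (star Z) \<le> (n - card Z) choose (k - card Z)"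
proof (cases "Z \<subseteq> X")
  case True
  have "card (star Z) \<le> card {B. B \<subseteq> X - Z \<and> card B = k - card Z}"
  proof (rule card_inj_on_le[of "\<lambda>A. A - Z"])
    show "inj_on (\<lambda>A. A - Z) (star Z)"
      by (auto simp: inj_on_def star_def)
    show "(\<lambda>A. A - Z) ` star Z \<subseteq> {B. B \<subseteq> X - Z \<and> card B = k - card Z}"
      using F_sub F_card assms by (auto simp: star_def card_Diff_subset)
  qed (use finite_X in simp)
  also have "\<dots> = (n - card Z) choose (k - card Z)"
    using finite_X True assms card_X by (simp add: n_subsets card_Diff_subset)
  finally show ?thesis .
next
  case False
  then have "star Z = {}" using F_sub by (auto simp: star_def)
  then show ?thesis by simp
qed

lemma card_star2_le: "x \<noteq> y \<Longrightarrow> card (star {x, y}) \<le> (n - 2) choose (k - 2)"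
  using card_star_le[of "{x, y}"] by (simp add: numeral_2_eq_2)

lemma card_star3_le:
  "x \<noteq> y \<Longrightarrow> x \<noteq> z \<Longrightarrow> y \<noteq> z \<Longrightarrow> card (star {x, y, z}) \<le> (n - 3) choose (k - 3)"
  using card_star_le[of "{x, y, z}"] by (simp add: numeral_3_eq_3)

end

locale nontrivial_intersecting_family = uniform_family +
  assumes intersecting: "A \<in> F \<Longrightarrow> B \<in> F \<Longrightarrow> A \<inter> B \<noteq> {}"
    and nontrivial: "\<exists>A\<in>F. x \<notin> A"
begin

text \<open>Each member meets a fixed \<open>A\<close> in some \<open>a\<close>, then a member
  avoiding \<open>a\<close> in some \<open>b\<close>, then a member avoiding \<open>a\<close> and
  \<open>b\<close> in some \<open>c\<close>. There are at most \<open>k ^ 3\<close> such triples,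
  each with distinct entries.\<close>

lemma card_le_no_2_cover:
  assumes "\<And>x y. \<exists>A\<in>F. x \<notin> A \<and> y \<notin> A"
  shows "card F \<le> k ^ 3 * ((n - 3) choose (k - 3))"
proof -
  from assms obtain C where C: "C x y \<in> F" "x \<notin> C x y" "y \<notin> C x y" for x y by metis
  obtain A where A: "A \<in> F" using nontrivial by blast
  have "F \<subseteq> (\<Union>a\<in>A. \<Union>b\<in>C a a. \<Union>c\<in>C a b. star {a, b, c})"
  proof
    fix D assume D: "D \<in> F"
    obtain a where a: "a \<in> A" "a \<in> D" using intersecting[OF A D] by blast
    obtain b where b: "b \<in> C a a" "b \<in> D" using intersecting[OF C(1) D] by blast
    obtain c where c: "c \<in> C a b" "c \<in> D" using intersecting[OF C(1) D] by blast
    show "D \<in> (\<Union>a\<in>A. \<Union>b\<in>C a a. \<Union>c\<in>C a b. star {a, b, c})"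
      using a b c D by (auto simp: star_def)
  qed
  then have "card F \<le> card (\<Union>a\<in>A. \<Union>b\<in>C a a. \<Union>c\<in>C a b. star {a, b, c})"
    using finite_member A C(1) finite_F by (intro card_mono) (auto simp: star_def)
  also have "\<dots> \<le> k * (k * (k * ((n - 3) choose (k - 3))))"
  proof (intro card_UN_le_mult)
    fix a b c assume "b \<in> C a a" "c \<in> C a b"
    then show "card (star {a, b, c}) \<le> (n - 3) choose (k - 3)"
      using C(2,3) by (intro card_star3_le) metis+
  qed (use finite_member F_card A C(1) in auto)
  finally show ?thesis by (simp add: power3_eq_cube mult.assoc)
qed

definition half :: "'a \<Rightarrow> 'a \<Rightarrow> 'a set set" where
  "half x y = {A \<in> F. x \<in> A \<and> y \<notin> A}"

text \<open>Every member of \<open>half x y\<close> meets \<open>B\<close> in one of its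
  \<open>k - 1\<close> elements other than \<open>y\<close>, and such an element differs from
  \<open>x\<close>.\<close>

lemma card_half_le:
  assumes "B \<in> half y x"
  shows "card (half x y) \<le> (k - 1) * ((n - 2) choose (k - 2))"
proof -
  have B: "B \<in> F" "y \<in> B" "x \<notin> B" using assms by (auto simp: half_def)
  have "half x y \<subseteq> (\<Union>b\<in>B - {y}. star {x, b})"
    using intersecting[OF B(1)] by (fastforce simp: half_def star_def)
  then have "card (half x y) \<le> card (\<Union>b\<in>B - {y}. star {x, b})"
    using finite_member[OF B(1)] finite_F by (intro card_mono) (auto simp: star_def)
  also have "\<dots> \<le> (k - 1) * ((n - 2) choose (k - 2))"
    using finite_member[OF B(1)] F_card[OF B(1)] B
    by (intro card_UN_le_mult card_star2_le) auto
  finally show ?thesis .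
qed

lemma card_half_le_1_cover:
  assumes "z \<noteq> x" "\<And>A. A \<in> half x y \<Longrightarrow> z \<in> A"
  shows "card (half x y) \<le> (n - 2) choose (k - 2)"
proof -
  have "card (half x y) \<le> card (star {x, z})"
    using assms(2) finite_F by (intro card_mono) (auto simp: half_def star_def)
  also have "\<dots> \<le> (n - 2) choose (k - 2)"
    using assms(1) by (intro card_star2_le) auto
  finally show ?thesis .
qed

text \<open>Two rounds of branching: a member of \<open>half x y\<close> meets \<open>C x\<close> in
  some \<open>b\<close> and then \<open>C b\<close> in some \<open>c\<close>. Both sets contain
  \<open>y\<close>, which the member avoids, so each round has \<open>k - 1\<close> choices.\<close>

lemma card_half_le_no_1_cover:
  assumes no: "\<And>z. z \<noteq> y \<Longrightarrow> \<exists>B\<in>half y x. z \<notin> B" and "x \<noteq> y"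
  shows "card (half x y) \<le> (k - 1) ^ 2 * ((n - 3) choose (k - 3))"
proof -
  from no obtain C where C: "z \<noteq> y \<Longrightarrow> C z \<in> half y x \<and> z \<notin> C z" for z by metis
  then have C': "z \<noteq> y \<Longrightarrow> C z \<in> F \<and> y \<in> C z \<and> x \<notin> C z \<and> z \<notin> C z" for z
    by (auto simp: half_def)
  let ?B = "C x"
  have B: "?B \<in> F" "y \<in> ?B" "x \<notin> ?B" using C'[OF assms(2)] by auto
  have "half x y \<subseteq> (\<Union>b\<in>?B - {y}. \<Union>c\<in>C b - {y}. star {x, b, c})"
  proof
    fix D assume "D \<in> half x y"
    then have D: "D \<in> F" "x \<in> D" "y \<notin> D" by (auto simp: half_def)
    obtain b where b: "b \<in> ?B" "b \<in> D" using intersecting[OF B(1) D(1)] by blast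
    then have "b \<noteq> y" using D by auto
    then have "C b \<in> F" using C'[of b] by blast
    from intersecting[OF this D(1)] obtain c where c: "c \<in> C b" "c \<in> D" by blast
    show "D \<in> (\<Union>b\<in>?B - {y}. \<Union>c\<in>C b - {y}. star {x, b, c})"
      using b c D \<open>b \<noteq> y\<close> by (auto simp: star_def)
  qed
  moreover have "(\<Union>b\<in>?B - {y}. \<Union>c\<in>C b - {y}. star {x, b, c}) \<subseteq> F"
    by (auto simp: star_def)
  ultimately have "card (half x y) \<le> card (\<Union>b\<in>?B - {y}. \<Union>c\<in>C b - {y}. star {x, b, c})"
    by (intro card_mono finite_subset[OF _ finite_F])
  also have "\<dots> \<le> (k - 1) * ((k - 1) * ((n - 3) choose (k - 3)))"
  proof (intro card_UN_le_mult)
    fix b c assume bc: "b \<in> ?B - {y}" "c \<in> C b - {y}"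
    then show "card (star {x, b, c}) \<le> (n - 3) choose (k - 3)"
      using C'[of b] B by (intro card_star3_le) auto
  next
    fix b assume "b \<in> ?B - {y}"
    then show "finite (C b - {y})" "card (C b - {y}) \<le> k - 1"
      using C'[of b] finite_member F_card by auto
  qed (use finite_member F_card B in auto)
  finally show ?thesis by (simp add: power2_eq_square mult.assoc)
qed

text \<open>If the members of one half share a further point, that half has at most
  \<open>(n - 2) choose (k - 2)\<close> members and the other at most \<open>k - 1\<close> times as
  many. Otherwise each half serves as the branching family for the other.\<close>

lemma card_le_2_cover:
  assumes cover: "\<And>A. A \<in> F \<Longrightarrow> x \<in> A \<or> y \<in> A" and "1 \<le> k"
  shows "card F \<le> (k + 1) * ((n - 2) choose (k - 2)) \<or>
    card F \<le> ((n - 2) choose (k - 2)) + 2 * ((k - 1) ^ 2 * ((n - 3) choose (k - 3)))"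
proof -
  let ?D = "(n - 2) choose (k - 2)"
  have xy: "x \<noteq> y" using cover nontrivial by blast
  have "F = star {x, y} \<union> half x y \<union> half y x"
    using cover by (auto simp: star_def half_def)
  then have "card F \<le> card (star {x, y} \<union> half x y) + card (half y x)"
    by (metis card_Un_le)
  also have "\<dots> \<le> card (star {x, y}) + card (half x y) + card (half y x)"
    by (rule add_right_mono[OF card_Un_le])
  finally have le: "card F \<le> ?D + card (half x y) + card (half y x)"
    using card_star2_le[OF xy] by linarith
  obtain A B where "A \<in> F" "y \<notin> A" "B \<in> F" "x \<notin> B"
    using nontrivial by metis
  then have "A \<in> half x y" "B \<in> half y x"
    using cover by (auto simp: half_def)
  then have halves: "card (half x y) \<le> (k - 1) * ?D" "card (half y x) \<le> (k - 1) * ?D"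
    using card_half_le by blast+
  have k: "(k + 1) * ?D = ?D + (k - 1) * ?D + ?D"
    using \<open>1 \<le> k\<close> by (cases k) auto
  consider "\<exists>z. z \<noteq> x \<and> (\<forall>A\<in>half x y. z \<in> A)" | "\<exists>z. z \<noteq> y \<and> (\<forall>A\<in>half y x. z \<in> A)"
    | "\<And>z. z \<noteq> x \<Longrightarrow> \<exists>A\<in>half x y. z \<notin> A" "\<And>z. z \<noteq> y \<Longrightarrow> \<exists>A\<in>half y x. z \<notin> A"
    by blast
  then show ?thesis
  proof cases
    case 1
    then have "card (half x y) \<le> ?D" using card_half_le_1_cover by blast
    with le halves k show ?thesis by linarith
  next
    case 2
    then have "card (half y x) \<le> ?D" using card_half_le_1_cover by blast
    with le halves k show ?thesis by linarith
  next
    case 3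
    have "card (half x y) \<le> (k - 1) ^ 2 * ((n - 3) choose (k - 3))"
      using 3(2) xy by (rule card_half_le_no_1_cover)
    moreover have "card (half y x) \<le> (k - 1) ^ 2 * ((n - 3) choose (k - 3))"
      using 3(1) xy by (intro card_half_le_no_1_cover) auto
    ultimately show ?thesis using le by linarith
  qed
qed

theorem card_le:
  assumes "3 \<le> k" and large: "k ^ 3 + 2 \<le> n"
  shows "card F \<le> (k + 1) * ((n - 2) choose (k - 2))"
proof -
  let ?D = "(n - 2) choose (k - 2)" and ?E = "(n - 3) choose (k - 3)"
  \<comment> \<open>This absorption identity trades \<open>?E\<close> for \<open>?D\<close>; with
    \<open>k ^ 3 \<le> n - 2\<close> it makes both bounds in terms of \<open>?E\<close> small
    enough.\<close>
  have "(k - 2) * ?D = (n - 2) * ((n - 2 - 1) choose (k - 2 - 1))"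
    using assms by (intro times_binomial_minus1_eq) simp
  then have DE: "(k - 2) * ?D = (n - 2) * ?E" by simp
  have k0: "0 < k - 2" using assms by simp
  have "(k - 2) * (k ^ 3 * ?E) \<le> (k - 2) * ((k + 1) * ?D)"
  proof -
    have "(k - 2) * k ^ 3 \<le> (k + 1) * (n - 2)"
      using large by (intro mult_le_mono) auto
    from mult_le_mono1[OF this, of ?E]
    have "(k - 2) * (k ^ 3 * ?E) \<le> (k + 1) * ((n - 2) * ?E)"
      by (simp only: mult.assoc)
    also have "\<dots> = (k - 2) * ((k + 1) * ?D)"
      by (simp only: DE[symmetric] mult.left_commute)
    finally show ?thesis .
  qed
  then have triples: "k ^ 3 * ?E \<le> (k + 1) * ?D" using k0 by simp
  have "(k - 2) * (2 * ((k - 1) ^ 2 * ?E)) \<le> (k - 2) * (k * ?D)"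
  proof -
    have "2 * ((k - 2) * (k - 1) ^ 2) \<le> k * (k * k ^ 2)"
      using assms(1) by (intro mult_le_mono power_mono) auto
    also have "\<dots> = k * k ^ 3" by (simp add: power2_eq_square power3_eq_cube)
    also have "\<dots> \<le> k * (n - 2)" using large by (intro mult_le_mono2) simp
    finally have "2 * ((k - 2) * (k - 1) ^ 2) * ?E \<le> k * (n - 2) * ?E"
      by (rule mult_le_mono1)
    also have "\<dots> = (k - 2) * (k * ?D)"
      by (simp only: DE[symmetric] mult.left_commute mult.assoc)
    finally show ?thesis by (simp only: mult.left_commute mult.assoc)
  qed
  then have pairs: "2 * ((k - 1) ^ 2 * ?E) \<le> k * ?D" using k0 by simp
  show ?thesis
  proof (cases "\<exists>x y. \<forall>A\<in>F. x \<in> A \<or> y \<in> A")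
    case True
    then obtain x y where "\<And>A. A \<in> F \<Longrightarrow> x \<in> A \<or> y \<in> A" by blast
    from card_le_2_cover[OF this] assms pairs show ?thesis by auto
  next
    case False
    then have "card F \<le> k ^ 3 * ?E" by (intro card_le_no_2_cover) blast
    with triples show ?thesis by linarith
  qed
qed

end

subsection \<open>Counting stable sets\<close>

lemma card_close_le:
  assumes "a \<in> {1..n}"
  shows "card {v \<in> {1..n}. cyc_dist n v a < 3} \<le> 5"
proof -
  \<comment> \<open>The images are \<open>a - 2\<close>, ..., \<open>a + 2\<close> modulo
    \<open>n\<close>, moved into \<open>{1..n}\<close>.\<close>
  have "{v \<in> {1..n}. cyc_dist n v a < 3} \<subseteq> (\<lambda>t. (a + n + t - 3) mod n + 1) ` {..<5}"
  proof
    fix v assume "v \<in> {v \<in> {1..n}. cyc_dist n v a < 3}"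
    then have v: "1 \<le> v" "v \<le> n" and close: "cyc_dist n v a < 3" by auto
    have a: "1 \<le> a" "a \<le> n" using assms by auto
    have "\<exists>t<5. a + n + t - 3 = v - 1 \<or> a + n + t - 3 = v - 1 + n \<or> a + n + t - 3 = v - 1 + 2 * n"
    proof -
      consider "v \<le> a" "a \<le> v + 2" | "v \<le> a" "n + v \<le> a + 2" | "a \<le> v" "v \<le> a + 2"
        | "a \<le> v" "n + a \<le> v + 2"
      proof -
        have "v \<le> a \<and> a \<le> v + 2 \<or> v \<le> a \<and> n + v \<le> a + 2 \<or> a \<le> v \<and> v \<le> a + 2 \<or>
            a \<le> v \<and> n + a \<le> v + 2"
          using close v a unfolding cyc_dist_def min_less_iff_disj by (cases "v \<le> a"; simp; linarith)
        with that show thesis by blast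
      qed
      then show ?thesis
      proof cases
        case 1
        then show ?thesis using v a by (intro exI[of _ "v + 2 - a"]) auto
      next
        case 2
        then show ?thesis using v a by (intro exI[of _ "2 + n + v - a"]) auto
      next
        case 3
        then show ?thesis using v a by (intro exI[of _ "v + 2 - a"]) auto
      next
        case 4
        then show ?thesis using v a by (intro exI[of _ "v + 2 - (n + a)"]) auto
      qed
    qed
    then obtain t where "t < 5" and
      "a + n + t - 3 = v - 1 \<or> a + n + t - 3 = v - 1 + n \<or> a + n + t - 3 = v - 1 + 2 * n"
      by blast
    moreover from this(2) have "(a + n + t - 3) mod n = (v - 1) mod n"
      by (elim disjE) (simp_all only: mod_add_self2 mod_mult_self1)
    ultimately have "t < 5" "(a + n + t - 3) mod n = (v - 1) mod n" by blast+
    then show "v \<in> (\<lambda>t. (a + n + t - 3) mod n + 1) ` {..<5}"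
      using v by (intro image_eqI[of _ _ t]) auto
  qed
  then have "card {v \<in> {1..n}. cyc_dist n v a < 3} \<le> card ((\<lambda>t. (a + n + t - 3) mod n + 1) ` {..<5::nat})"
    by (intro card_mono) auto
  also have "\<dots> \<le> card {..<5::nat}" by (rule card_image_le) simp
  finally show ?thesis by simp
qed

text \<open>Double counting of one-point extensions: each of the \<open>i\<close> elements blocks at
  most five vertices, and a set of size \<open>Suc i\<close> arises from at most
  \<open>Suc i\<close> extensions.\<close>

lemma card_stable_ksets_Suc:
  "(n - 5 * i) * card (stable_ksets n i 3) \<le> Suc i * card (stable_ksets n (Suc i) 3)"
proof -
  let ?V = "\<lambda>i. stable_ksets n i 3"
  define free where "free A = {v \<in> {1..n} - A. insert v A \<in> ?V (Suc i)}" for A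
  have fin: "finite A" if "A \<in> ?V i" for A i
    using that finite_subset by (auto simp: stable_ksets_def)
  have "n - 5 * i \<le> card (free A)" if A: "A \<in> ?V i" for A
  proof -
    let ?close = "\<lambda>a. {v \<in> {1..n}. cyc_dist n v a < 3}"
    have "card (\<Union>a\<in>A. ?close a) \<le> i * 5"
      using A fin[OF A] card_close_le by (intro card_UN_le_mult) (auto simp: stable_ksets_def)
    moreover have "{1..n} - (\<Union>a\<in>A. ?close a) \<subseteq> free A"
    proof
      fix v assume v: "v \<in> {1..n} - (\<Union>a\<in>A. ?close a)"
      then have far: "3 \<le> cyc_dist n v a" if "a \<in> A" for a using that by fastforce
      have "cyc_dist n v v = 0" by (simp add: cyc_dist_def)
      then have "v \<notin> A" using far by fastforce
      then show "v \<in> free A"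
        using v far A fin[OF A] by (auto simp: free_def stable_ksets_def s_stable_def cyc_dist_commute)
    qed
    then have "card ({1..n} - (\<Union>a\<in>A. ?close a)) \<le> card (free A)"
      by (intro card_mono) (auto simp: free_def)
    moreover have "n - card (\<Union>a\<in>A. ?close a) \<le> card ({1..n} - (\<Union>a\<in>A. ?close a))"
      using diff_card_le_card_Diff[of "\<Union>a\<in>A. ?close a" "{1..n}"] fin[OF A] by auto
    ultimately show ?thesis by linarith
  qed
  then have "(\<Sum>A\<in>?V i. n - 5 * i) \<le> (\<Sum>A\<in>?V i. card (free A))"
    by (rule sum_mono)
  also have "\<dots> = card (Sigma (?V i) free)"
    using finite_stable_ksets by (intro card_SigmaI[symmetric]) (auto simp: free_def)
  also have "\<dots> \<le> card (Sigma (?V (Suc i)) (\<lambda>C. C))"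
  proof (rule card_inj_on_le[of "\<lambda>(A, v). (insert v A, v)"])
    show "inj_on (\<lambda>(A, v). (insert v A, v)) (Sigma (?V i) free)"
      by (auto simp: inj_on_def free_def insert_ident)
    show "(\<lambda>(A, v). (insert v A, v)) ` Sigma (?V i) free \<subseteq> Sigma (?V (Suc i)) (\<lambda>C. C)"
      by (auto simp: free_def)
    show "finite (Sigma (?V (Suc i)) (\<lambda>C. C))"
      using finite_stable_ksets fin by auto
  qed
  also have "\<dots> = (\<Sum>C\<in>?V (Suc i). card C)"
    using finite_stable_ksets fin by (intro card_SigmaI) auto
  also have "\<dots> = (\<Sum>C\<in>?V (Suc i). Suc i)"
    by (rule sum.cong) (auto simp: stable_ksets_def)
  finally show ?thesis by (simp add: mult.commute)
qed

lemma prod_le_card_stable_ksets: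
  "(\<Prod>i<k. n - 5 * i) \<le> fact k * card (stable_ksets n k 3)"
proof (induction k)
  case 0
  have "{} \<in> stable_ksets n 0 3" by (simp add: stable_ksets_def s_stable_def)
  then have "0 < card (stable_ksets n 0 3)" using finite_stable_ksets card_gt_0_iff by blast
  then show ?case by simp
next
  case (Suc k)
  have "(\<Prod>i<Suc k. n - 5 * i) \<le> fact k * ((n - 5 * k) * card (stable_ksets n k 3))"
    using mult_le_mono1[OF Suc.IH, of "n - 5 * k"] by (simp add: ac_simps)
  also have "\<dots> \<le> fact k * (Suc k * card (stable_ksets n (Suc k) 3))"
    by (intro mult_le_mono2 card_stable_ksets_Suc)
  finally show ?case
    unfolding fact_Suc by (simp only: of_nat_id mult.assoc mult.left_commute)
qed

text \<open>With \<open>d = i + 2\<close>, the factors have ratio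
  \<open>(n - 5 * d) / (n - d)\<close>, which is at least \<open>1 - 4 * d / (n - k)\<close>. A
  product of such terms is at least \<open>1\<close> minus the sum of the losses, and the values
  \<open>4 * d\<close> add up to \<open>2 * j ^ 2 + 6 * j\<close>.\<close>

lemma prod_ratio_bound:
  fixes n k :: real and j :: nat
  assumes "real j + 2 \<le> k" "5 * k \<le> n"
  shows "(n - k - (2 * real j ^ 2 + 6 * real j)) * (\<Prod>i<j. n - 2 - real i)
    \<le> (n - k) * (\<Prod>i<j. n - 5 * (real i + 2))"
  using assms(1)
proof (induction j)
  case (Suc j)
  define d s R P where "d = real j + 2" and "s = 2 * real j ^ 2 + 6 * real j"
    and "R = (\<Prod>i<j. n - 2 - real i)" and "P = (\<Prod>i<j. n - 5 * (real i + 2))"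
  have d: "0 < d" "d \<le> k" and s: "0 \<le> s" using Suc.prems by (auto simp: d_def s_def)
  have R: "0 \<le> R" unfolding R_def using Suc.prems assms(2) by (intro prod_nonneg) auto
  have IH: "(n - k - s) * R \<le> (n - k) * P"
    using Suc by (simp add: s_def R_def P_def)
  have "(n - k - s) * (n - 5 * d) - (n - k - s - 4 * d) * (n - d) = 4 * d * (k - d + s)"
    by (simp add: algebra_simps)
  moreover have "0 \<le> 4 * d * (k - d + s)" using d s by simp
  ultimately have "(n - k - s - 4 * d) * (n - d) * R \<le> (n - k - s) * (n - 5 * d) * R"
    using R by (intro mult_right_mono) auto
  also have "\<dots> = (n - k - s) * R * (n - 5 * d)" by simp
  also have "\<dots> \<le> (n - k) * P * (n - 5 * d)"
    using IH d assms(2) by (intro mult_right_mono) auto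
  finally have "(n - k - s - 4 * d) * (R * (n - d)) \<le> (n - k) * (P * (n - 5 * d))"
    by (simp add: ac_simps)
  moreover have "n - k - (2 * real (Suc j) ^ 2 + 6 * real (Suc j)) = n - k - s - 4 * d"
    by (simp add: s_def d_def power2_eq_square algebra_simps)
  moreover have "(\<Prod>i<Suc j. n - 2 - real i) = R * (n - d)"
    by (simp add: R_def d_def algebra_simps)
  moreover have "(\<Prod>i<Suc j. n - 5 * (real i + 2)) = P * (n - 5 * d)"
    by (simp add: P_def d_def)
  ultimately show ?case by (simp only:)
qed simp

lemma card_nontrivial_families_less:
  assumes k: "4 \<le> k" and n: "k ^ 3 + 3 * k ^ 2 \<le> n"
  shows "(n - 3 * k + 2) * ((k + 1) * ((n - 2) choose (k - 2))) < card (stable_ksets n k 3)"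
proof -
  obtain j where j: "k = j + 2" using k by (intro that[of "k - 2"]) simp
  define x y where "x = real k" and "y = real n"
  have x: "4 \<le> x" using k by (simp add: x_def)
  have "real (k ^ 3 + 3 * k ^ 2) \<le> real n" using n by (simp only: of_nat_le_iff)
  then have xy: "x ^ 3 + 3 * x ^ 2 \<le> y" by (simp add: x_def y_def)
  have sq: "4 * x \<le> x ^ 2" using x by (simp add: power2_eq_square)
  have cube: "4 * x ^ 2 \<le> x ^ 3" using x by (simp add: power2_eq_square power3_eq_cube mult_mono)
  have y: "5 * x \<le> y" "x < y" using sq cube xy x by linarith+
  let ?R = "\<Prod>i<j. y - 2 - real i" and ?P = "\<Prod>i<j. y - 5 * (real i + 2)"
  have jx: "real j = x - 2" using j by (simp add: x_def)
  have R: "0 < ?R" using y x jx by (intro prod_pos) auto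
  \<comment> \<open>At \<open>j = x - 2\<close> the loss \<open>2 * j ^ 2 + 6 * j\<close> becomes
    \<open>2 * x ^ 2 - 2 * x - 4\<close>.\<close>
  have bound: "(y - x - (2 * x ^ 2 - 2 * x - 4)) * ?R \<le> (y - x) * ?P"
    using prod_ratio_bound[of j x y] y jx by (simp add: power2_eq_square algebra_simps)
  have ineq: "(y - 3 * x + 2) * (x + 1) * x * (x - 1) * (y - x) < y * (y - 5) * (y - x - (2 * x ^ 2 - 2 * x - 4))"
  proof -
    have a: "(y - 3 * x + 2) * (y - x) \<le> y * (y - 5)"
    proof -
      have "y * (y - 5) - (y - 3 * x + 2) * (y - x) = (4 * x - 7) * y - 3 * x ^ 2 + 2 * x"
        by (simp add: algebra_simps power2_eq_square)
      moreover have "1 * y \<le> (4 * x - 7) * y" using x y by (intro mult_right_mono) auto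
      ultimately show ?thesis using xy cube x sq by linarith
    qed
    \<comment> \<open>The left side is \<open>x ^ 3 - x\<close>, and the summand
      \<open>3 * x ^ 2\<close> in the bound on \<open>n\<close> absorbs the loss.\<close>
    have b: "(x + 1) * x * (x - 1) < y - x - (2 * x ^ 2 - 2 * x - 4)"
    proof -
      have "(x + 1) * x * (x - 1) = x ^ 3 - x"
        by (simp add: algebra_simps power3_eq_cube)
      then show ?thesis using xy x sq by linarith
    qed
    have pos: "0 < y * (y - 5)" using y x by simp
    have "(y - 3 * x + 2) * (y - x) * ((x + 1) * x * (x - 1)) \<le> y * (y - 5) * ((x + 1) * x * (x - 1))"
      using a x by (intro mult_right_mono) auto
    also have "\<dots> < y * (y - 5) * (y - x - (2 * x ^ 2 - 2 * x - 4))"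
      using b pos by (intro mult_strict_left_mono)
    finally show ?thesis by (simp add: ac_simps)
  qed
  have "(y - 3 * x + 2) * (x + 1) * x * (x - 1) * ?R * (y - x) < y * (y - 5) * ?P * (y - x)"
  proof -
    have "(y - 3 * x + 2) * (x + 1) * x * (x - 1) * (y - x) * ?R
        < y * (y - 5) * (y - x - (2 * x ^ 2 - 2 * x - 4)) * ?R"
      using ineq R by (rule mult_strict_right_mono)
    also have "\<dots> \<le> y * (y - 5) * ((y - x) * ?P)"
      using bound y x by (simp add: mult.assoc mult_left_mono)
    finally show ?thesis by (simp add: ac_simps)
  qed
  then have main: "(y - 3 * x + 2) * (x + 1) * x * (x - 1) * ?R < y * (y - 5) * ?P"
    using y by (simp add: mult_less_cancel_right)
  have "3 * k \<le> n" "5 * k \<le> n" using y x unfolding x_def y_def by linarith+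
  have R_eq: "?R = fact j * real ((n - 2) choose j)"
  proof -
    have "real ((n - 2) choose j) = (y - 2) gchoose j"
      using y x by (simp add: y_def x_def binomial_gbinomial of_nat_diff)
    then show ?thesis by (simp add: gbinomial_mult_fact atLeast0LessThan)
  qed
  have fact_eq: "fact k = x * (x - 1) * fact j"
    using j by (simp add: x_def algebra_simps)
  have P_eq: "y * (y - 5) * ?P = real (\<Prod>i<k. n - 5 * i)"
  proof -
    have "real (\<Prod>i<k. n - 5 * i) = (\<Prod>i<k. y - 5 * real i)"
      unfolding of_nat_prod using \<open>5 * k \<le> n\<close>
      by (intro prod.cong) (auto simp: y_def of_nat_diff)
    also have "\<dots> = y * ((y - 5) * ?P)"
      unfolding j by (simp add: prod.lessThan_Suc_shift algebra_simps del: prod.lessThan_Suc)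
    finally show ?thesis by simp
  qed
  have m_eq: "real (n - 3 * k + 2) = y - 3 * x + 2"
    using \<open>3 * k \<le> n\<close> by (simp add: x_def y_def of_nat_diff)
  have k_eq: "real (k + 1) = x + 1" "k - 2 = j" using j by (simp_all add: x_def)
  have "real ((n - 3 * k + 2) * ((k + 1) * ((n - 2) choose (k - 2)))) * fact k
      = (y - 3 * x + 2) * (x + 1) * x * (x - 1) * ?R"
    unfolding of_nat_mult m_eq k_eq R_eq fact_eq by (simp only: mult.assoc mult.left_commute mult.commute)
  also have "\<dots> < real (\<Prod>i<k. n - 5 * i)" using main P_eq by simp
  also have "\<dots> \<le> real (card (stable_ksets n k 3)) * fact k"
    using prod_le_card_stable_ksets[of n k] by (metis mult.commute of_nat_fact of_nat_le_iff of_nat_mult)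
  finally show ?thesis
    by (simp only: mult_less_cancel_right_pos fact_gt_zero of_nat_less_iff)
qed

subsection \<open>A colour class with a common element\<close>

text \<open>Rotates the cycle on \<open>{0..n - 1}\<close> onto \<open>{1..n}\<close> so that
  position \<open>0\<close>, the removed vertex, goes to \<open>i\<close>.\<close>

definition cyc_shift :: "nat \<Rightarrow> nat \<Rightarrow> nat \<Rightarrow> nat" where
  "cyc_shift n i p = (if i + p \<le> n then i + p else i + p - n)"

lemma cyc_dist_cyc_shift:
  assumes "i \<in> {1..n}" "p < q" "q < n"
  shows "cyc_dist n (cyc_shift n i p) (cyc_shift n i q) = min (q - p) (n - (q - p))"
  using assms by (auto simp: cyc_dist_def cyc_shift_def min_def)

lemma inj_on_cyc_shift: "i \<in> {1..n} \<Longrightarrow> inj_on (cyc_shift n i) {1..n - 1}"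
  by (auto simp: inj_on_def cyc_shift_def split: if_splits)

lemma cyc_shift_mem: "i \<in> {1..n} \<Longrightarrow> p \<in> {1..n - 1} \<Longrightarrow> cyc_shift n i p \<in> {1..n} - {i}"
  by (auto simp: cyc_shift_def)

lemma cyc_shift_image_stable:
  assumes i: "i \<in> {1..n}" and C: "cut_stable (n - 1) k C"
  shows "cyc_shift n i ` C \<in> stable_ksets n k 3"
proof -
  have sub: "C \<subseteq> {1..n - 1}" and "card C = k" using C by (auto simp: cut_stable_def)
  then have "card (cyc_shift n i ` C) = k"
    using card_image inj_on_subset[OF inj_on_cyc_shift[OF i]] by metis
  moreover have "cyc_shift n i ` C \<subseteq> {1..n}" using cyc_shift_mem[OF i] sub by blast
  moreover have less: "3 \<le> cyc_dist n (cyc_shift n i p) (cyc_shift n i q)"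
    if pq: "p \<in> C" "q \<in> C" "p < q" for p q
  proof -
    have "p + 3 \<le> q" using C pq by (simp add: cut_stable_def spread_def)
    moreover have "1 \<le> p" "q \<le> n - 1" using sub pq by auto
    \<comment> \<open>Among positions at least 3 apart, only the two ends are too close across the
      removed vertex.\<close>
    moreover have "p \<noteq> 1 \<or> q \<noteq> n - 1" using C pq by (auto simp: cut_stable_def)
    ultimately show ?thesis
      using cyc_dist_cyc_shift[OF i pq(3)] by auto
  qed
  have "3 \<le> cyc_dist n (cyc_shift n i p) (cyc_shift n i q)"
    if "p \<in> C" "q \<in> C" "p \<noteq> q" for p q
    using less[of p q] less[of q p] that by (metis cyc_dist_commute linorder_neqE_nat)
  then have "s_stable n 3 (cyc_shift n i ` C)" by (auto simp: s_stable_def)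
  ultimately show ?thesis by (simp add: stable_ksets_def)
qed

text \<open>If \<open>i\<close> were common to class \<open>j\<close>, the stable sets avoiding
  \<open>i\<close> would use only the other \<open>m - 1\<close> colours. The lower bound would give
  \<open>n - 1 \<le> 3 * k - 3 + (m - 1) = n - 2\<close>.\<close>

lemma colour_class_no_common_element:
  assumes c: "proper_colouring (stable_kneser_graph n k 3) m c"
    and m: "m + 3 * k = n + 2" "2 \<le> m" and k: "0 < k" and j: "j < m" and i: "i \<in> {1..n}"
  shows "\<exists>A\<in>stable_ksets n k 3. c A = j \<and> i \<notin> A"
proof (rule ccontr)
  assume "\<not> ?thesis"
  then have star: "c A \<noteq> j" if "A \<in> stable_ksets n k 3" "i \<notin> A" for A
    using that by blast
  let ?f = "\<lambda>C. cyc_shift n i ` C"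
  \<comment> \<open>Renumbers the colours to close the gap left by \<open>j\<close>.\<close>
  define c' where "c' C = (if c (?f C) < j then c (?f C) else c (?f C) - 1)" for C
  have f: "?f C \<in> stable_ksets n k 3" "c (?f C) \<noteq> j" "c (?f C) < m" if C: "cut_stable (n - 1) k C" for C
  proof -
    show stable: "?f C \<in> stable_ksets n k 3" by (rule cyc_shift_image_stable[OF i C])
    have "C \<subseteq> {1..n - 1}" using C by (simp add: cut_stable_def)
    then have "cyc_shift n i p \<noteq> i" if "p \<in> C" for p
      using cyc_shift_mem[OF i, of p] that by auto
    then have "i \<notin> ?f C" by force
    then show "c (?f C) \<noteq> j" using star stable by blast
    show "c (?f C) < m"
      using c stable by (simp add: proper_colouring_def stable_kneser_graph_def)
  qed
  interpret cut_cycle_colouring "n - 1" k "m - 1" c'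
  proof
    fix C assume "cut_stable (n - 1) k C"
    from f[OF this] j show "c' C < m - 1" by (auto simp: c'_def)
  next
    fix C D assume C: "cut_stable (n - 1) k C" and D: "cut_stable (n - 1) k D" and "C \<inter> D = {}"
    have sub: "C \<subseteq> {1..n - 1}" "D \<subseteq> {1..n - 1}" using C D by (auto simp: cut_stable_def)
    have "?f C \<inter> ?f D = {}"
      using inj_on_image_Int[OF inj_on_cyc_shift[OF i] sub] \<open>C \<inter> D = {}\<close> by simp
    moreover have "?f C \<noteq> {}" using C k by (auto simp: cut_stable_def)
    ultimately have "(?f C, ?f D) \<in> parcs (stable_kneser_graph n k 3)"
      using f(1)[OF C] f(1)[OF D] by (auto simp: stable_kneser_graph_def)
    then have "c (?f C) \<noteq> c (?f D)"
      using c by (auto simp: proper_colouring_def)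
    then show "c' C \<noteq> c' D"
      using f(2)[OF C] f(2)[OF D] by (auto simp: c'_def)
  qed (use k m in auto)
  show False using colours_lower_bound m k by linarith
qed

subsection \<open>The chromatic number\<close>

text \<open>Counted from the minimum, the elements lie in different blocks of three consecutive
  integers.\<close>

lemma stable_kset_Min_le:
  assumes A: "A \<in> stable_ksets n k 3" and "0 < k"
  shows "Min A + 3 * (k - 1) \<le> n"
proof -
  have fin: "finite A" "A \<noteq> {}" "card A = k" and sub: "A \<subseteq> {1..n}"
    using assms finite_subset by (auto simp: stable_ksets_def)
  define a where "a = Min A"
  have a: "a \<in> A" "\<And>x. x \<in> A \<Longrightarrow> a \<le> x" using fin by (auto simp: a_def)
  have "card A \<le> card {..(n - a) div 3}"
  proof (rule card_inj_on_le[of "\<lambda>x. (x - a) div 3"])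
    show "inj_on (\<lambda>x. (x - a) div 3) A"
    proof (rule linorder_inj_onI)
      fix x y assume xy: "x < y" "x \<in> A" "y \<in> A"
      then have "3 \<le> cyc_dist n x y" using A by (auto simp: stable_ksets_def s_stable_def)
      then have "x + 3 \<le> y" using xy(1) by (simp add: cyc_dist_def; linarith)
      then have "x - a + 3 \<le> y - a" using a xy by (simp add: diff_le_mono)
      then have "(x - a + 3) div 3 \<le> (y - a) div 3" by (rule div_le_mono)
      then show "(x - a) div 3 \<noteq> (y - a) div 3" by simp
    qed auto
    show "(\<lambda>x. (x - a) div 3) ` A \<subseteq> {..(n - a) div 3}"
      using sub by (auto intro!: div_le_mono diff_le_mono)
  qed simp
  then have "k - 1 \<le> (n - a) div 3" using fin by simp
  then have "3 * (k - 1) \<le> n - a" by (simp add: less_eq_div_iff_mult_less_eq mult.commute)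
  moreover have "a \<le> n" using a sub by auto
  ultimately show ?thesis by (simp add: a_def)
qed

lemma proper_colouring_Min:
  assumes "0 < k"
  shows "proper_colouring (stable_kneser_graph n k 3) (n + 3 - 3 * k) (\<lambda>A. Min A - 1)"
  unfolding proper_colouring_def
proof (intro conjI ballI)
  have Min: "Min A \<in> A" "1 \<le> Min A" if "A \<in> stable_ksets n k 3" for A
  proof -
    show "Min A \<in> A"
      using that assms finite_subset by (intro Min_in) (auto simp: stable_ksets_def)
    then show "1 \<le> Min A" using that by (auto simp: stable_ksets_def)
  qed
  show "Min A - 1 < n + 3 - 3 * k" if "A \<in> pverts (stable_kneser_graph n k 3)" for A
    using that Min(2)[of A] stable_kset_Min_le[of A n k] assms
    by (simp add: stable_kneser_graph_def)
  fix e assume "e \<in> parcs (stable_kneser_graph n k 3)"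
  then obtain A B where e: "e = (A, B)" "A \<in> stable_ksets n k 3" "B \<in> stable_ksets n k 3" "A \<inter> B = {}"
    by (auto simp: stable_kneser_graph_def)
  then have "Min A \<noteq> Min B" using Min(1) by fastforce
  then show "case e of (A, B) \<Rightarrow> Min A - 1 \<noteq> Min B - 1"
    using Min(2)[OF e(2)] Min(2)[OF e(3)] e(1) by auto
qed

lemma large_n:
  fixes n k :: nat
  assumes "4 \<le> k" "k ^ 3 + 3 * k ^ 2 \<le> n"
  shows "3 * k \<le> n" "k ^ 3 + 2 \<le> n"
proof -
  have "k \<le> k ^ 2" using assms(1) by (intro self_le_power) auto
  then show "3 * k \<le> n" "k ^ 3 + 2 \<le> n" using assms by linarith+
qed

lemma no_proper_colouring:
  assumes k: "4 \<le> k" and n: "k ^ 3 + 3 * k ^ 2 \<le> n"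
  shows "\<not> proper_colouring (stable_kneser_graph n k 3) (n - 3 * k + 2) c"
proof
  let ?V = "stable_ksets n k 3"
  define m where "m = n - 3 * k + 2"
  assume "proper_colouring (stable_kneser_graph n k 3) (n - 3 * k + 2) c"
  then have c: "proper_colouring (stable_kneser_graph n k 3) m c" by (simp add: m_def)
  note n3 = large_n(1)[OF k n] and large = large_n(2)[OF k n]
  define F where "F j = {A \<in> ?V. c A = j}" for j
  have F: "card (F j) \<le> (k + 1) * ((n - 2) choose (k - 2))" if j: "j < m" for j
  proof -
    have no_common: "\<exists>A\<in>F j. i \<notin> A" if "i \<in> {1..n}" for i
      using colour_class_no_common_element[OF c _ _ _ j that] n3 k by (auto simp: F_def m_def)
    interpret nontrivial_intersecting_family "{1..n}" n k "F j"
    proof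
      show "A \<subseteq> {1..n}" "card A = k" if "A \<in> F j" for A
        using that by (auto simp: F_def stable_ksets_def)
      show "A \<inter> B \<noteq> {}" if "A \<in> F j" "B \<in> F j" for A B
      proof (cases "A = B")
        case True
        then show ?thesis using that k by (auto simp: F_def stable_ksets_def)
      next
        case False
        then show ?thesis
          using that c by (auto simp: F_def proper_colouring_def stable_kneser_graph_def)
      qed
      show "\<exists>A\<in>F j. x \<notin> A" for x
      proof (cases "x \<in> {1..n}")
        \<comment> \<open>Any member avoids such an \<open>x\<close>; what has to be shown is that
          the class is nonempty.\<close>
        case False
        obtain A where "A \<in> F j" using no_common[of 1] n3 k by auto
        moreover from this have "A \<subseteq> {1..n}" by (simp add: F_def stable_ksets_def)
        ultimately show ?thesis using False by blast
      qed (rule no_common)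
    qed simp_all
    show ?thesis using card_le large k by simp
  qed
  have "?V \<subseteq> (\<Union>j\<in>{..<m}. F j)"
    using c by (auto simp: F_def proper_colouring_def stable_kneser_graph_def)
  then have "card ?V \<le> card (\<Union>j\<in>{..<m}. F j)"
    using finite_stable_ksets by (intro card_mono) (auto simp: F_def)
  also have "\<dots> \<le> m * ((k + 1) * ((n - 2) choose (k - 2)))"
    using F by (intro card_UN_le_mult) auto
  finally show False
    using card_nontrivial_families_less[OF k n] by (simp add: m_def)
qed

theorem theorem1p5:
  fixes n k :: nat
  assumes "4 \<le> k" and "k ^ 3 + 3 * k ^ 2 \<le> n"
  shows "int (chromatic_number (stable_kneser_graph n k 3)) = int n - 3 * int k + 3"
proof -
  let ?G = "stable_kneser_graph n k 3"
  interpret pair_graph ?G by (rule pair_graph_stable_kneser_graph)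
  have "3 * k \<le> n" using large_n(1)[OF assms] .
  moreover have "chromatic_number ?G \<le> n + 3 - 3 * k"
    unfolding chromatic_number_def
    using proper_colouring_Min[of k n] assms(1) by (intro Least_le) auto
  moreover have "n - 3 * k + 2 < chromatic_number ?G"
  proof (rule ccontr)
    assume le: "\<not> n - 3 * k + 2 < chromatic_number ?G"
    obtain c where "proper_colouring ?G (chromatic_number ?G) c"
      using chromatic_number_attained by blast
    with le have "proper_colouring ?G (n - 3 * k + 2) c"
      by (force simp: proper_colouring_def)
    with no_proper_colouring[OF assms] show False by blast
  qed
  ultimately show ?thesis by linarith
qed

end
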